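(* Let $m\geq 2$, $s\geq 1$, let $w$ be a preregular $m$-linear form on $\mathbb K^{s+1}$ and let $\mathcal A=\mathcal A(w,2)$ be the associated quadratic algebra. Then $\mathbf 1\otimes w$ is canonically a nontrivial ${}^w\mathcal A$-valued Hochschild $m$-cycle on $\mathcal A$, that is, one has $\mathbf 1\otimes w\in Z_m(\mathcal A,{}^w\mathcal A)$ and $\mathbf 1\otimes w\notin B_m(\mathcal A,{}^w\mathcal A)$.
   Context: $\mathbb K$ is an algebraically closed field of characteristic zero; algebras are unital associative over $\mathbb K$; $\otimes=\otimes_{\mathbb K}$; repeated up-down indices are summed. Preregular: an $m$-linear form $w$ on a vector space $V$ ($\dim V\geq 2$, $m\geq 2$) is preregular if (i) $w(X,X_1,\dots,X_{m-1})=0$ for all $X_1,\dots,X_{m-1}\in V$ implies $X=0$, and (ii) there is $Q_w\in GL(V)$ (necessarily unique) with $w(X_1,\dots,X_m)=w(Q_wX_m,X_1,\dots,X_{m-1})$ for all $X_i\in V$. $\mathcal A(w,2)$: with $W_{\lambda_1\dots\lambda_m}=w(e_{\lambda_1},\dots,e_{\lambda_m})$ in the canonical basis $(e_\lambda)$ of $\mathbb K^{s+1}$, it is the quadratic algebra generated by $x^0,\dots,x^s$ in degree 1 with the relations $W_{\lambda_1\dots\lambda_{m-2}\mu\nu}x^\mu x^\nu=0$ for all $\lambda_i\in\{0,\dots,s\}$. The space $\mathcal A_1=\oplus_\lambda\mathbb Kx^\lambda$ is identified with the dual of $\mathbb K^{s+1}$, $(x^\lambda)$ being the dual basis of $(e_\lambda)$,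 and $w$ is identified with $W_{\lambda_1\dots\lambda_m}x^{\lambda_1}\otimes\cdots\otimes x^{\lambda_m}\in\mathcal A_1^{\otimes m}\subset\mathcal A^{\otimes m}$. The automorphism $\sigma^w$: the transpose of $Q_w$, acting on $\mathcal A_1$ by $x^\lambda\mapsto(Q_w)^\lambda_\mu x^\mu$ (where $Q_we_\mu=(Q_w)^\lambda_\mu e_\lambda$), extends to an automorphism $\sigma^w$ of the graded algebra $\mathcal A$. The bimodule ${}^w\mathcal A$: it is the $(\mathcal A,\mathcal A)$-bimodule which coincides with $\mathcal A$ as right $\mathcal A$-module and in which $a\in\mathcal A_n$ acts on the left by left multiplication by $(-1)^{(m-1)n}(\sigma^w)^{-1}(a)$. Hochschild chains: for an $(\mathcal A,\mathcal A)$-bimodule $\mathcal M$, the $n$-chains are $\mathcal M\otimes\mathcal A^{\otimes n}$ with boundary $b(\xi\otimes a_1\otimes\cdots\otimes a_n)=\xi a_1\otimes a_2\otimes\cdots\otimes a_n+\sum_{k=1}^{n-1}(-1)^k\xi\otimes a_1\otimes\cdots\otimes a_ka_{k+1}\otimes\cdots\otimes a_n+(-1)^na_n\xi\otimes a_1\otimes\cdots\otimes a_{n-1}$; $Z_n(\mathcal A,\mathcal M)$ and $B_n(\mathcal A,\mathcal M)$ are the $n$-cycles and $n$-boundaries. In $\mathbf 1\otimes w$, $\mathbf 1$ is the unit of $\mathcal A$ viewed as an element of ${}^w\mathcal A$. *)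

theory Defs
  imports
    "HOL-Analysis.Cartesian_Space"
    "HOL-Library.Poly_Mapping"
    "HOL-Computational_Algebra.Polynomial"
    "HOL-Algebra.Module"
    "HOL-Algebra.QuotRing"
begin

section \<open>Free vector spaces and the free algebra\<close>

definition pscale :: "'k::field \<Rightarrow> ('x \<Rightarrow>\<^sub>0 'k) \<Rightarrow> ('x \<Rightarrow>\<^sub>0 'k)" where
  "pscale c = Poly_Mapping.map ((*) c)"

lemma lookup_pscale [simp]: "Poly_Mapping.lookup (pscale c f) x = c * Poly_Mapping.lookup f x"
  by (simp add: pscale_def Poly_Mapping.map.rep_eq when_def)

interpretation pm: vector_space "pscale :: 'k::field \<Rightarrow> ('x \<Rightarrow>\<^sub>0 'k) \<Rightarrow> _"
  by unfold_locales (auto intro!: poly_mapping_eqI simp: lookup_add algebra_simps)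

definition lin_ext :: "('x \<Rightarrow> ('y \<Rightarrow>\<^sub>0 'k)) \<Rightarrow> ('x \<Rightarrow>\<^sub>0 'k::field) \<Rightarrow> ('y \<Rightarrow>\<^sub>0 'k)" where
  "lin_ext g f = (\<Sum>x\<in>Poly_Mapping.keys f. pscale (Poly_Mapping.lookup f x) (g x))"

text \<open>
  With words as an additive monoid under concatenation, the convolution product of
  \<^theory>\<open>HOL-Library.Poly_Mapping\<close> makes \<open>'n list \<Rightarrow>\<^sub>0 'k\<close> the free unital associative algebra
  on the generators \<open>'n\<close>, i.e. the tensor algebra of the space with basis \<open>'n\<close>.
\<close>

instantiation list :: (type) monoid_add
begin
definition zero_list_def: "0 = []"
definition plus_list_def: "xs + ys = xs @ ys"
instance by standard (simp_all add: zero_list_def plus_list_def)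
end

definition free_alg :: "('n list \<Rightarrow>\<^sub>0 'k::field) ring" where
  "free_alg = \<lparr>carrier = UNIV, monoid.mult = (*), one = 1, ring.zero = 0, add = (+)\<rparr>"

lemma free_alg_ring: "ring free_alg"
  unfolding free_alg_def
  by unfold_locales (auto simp: Units_def algebra_simps intro: exI[of _ "- x" for x])

section \<open>Preregular multilinear forms\<close>

text \<open>
  An \<open>m\<close>-linear form on \<open>V\<close> is a function on lists of vectors; only its values on
  lists of length \<open>m\<close> are relevant.
\<close>

definition multilinear_form :: "nat \<Rightarrow> (('k::field ^ 'n) list \<Rightarrow> 'k) \<Rightarrow> bool" where
  "multilinear_form m w \<longleftrightarrow>
     (\<forall>xs ys. length xs + 1 + length ys = m \<longrightarrow>
        Vector_Spaces.linear (*s) (*) (\<lambda>v. w (xs @ v # ys)))"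

definition twists_form :: "nat \<Rightarrow> (('k::field ^ 'n) list \<Rightarrow> 'k) \<Rightarrow> 'k ^ 'n ^ 'n \<Rightarrow> bool" where
  "twists_form m w Q \<longleftrightarrow>
     invertible Q \<and> (\<forall>xs x. length xs = m - 1 \<longrightarrow> w (xs @ [x]) = w ((Q *v x) # xs))"

definition preregular :: "nat \<Rightarrow> (('k::field ^ 'n) list \<Rightarrow> 'k) \<Rightarrow> bool" where
  "preregular m w \<longleftrightarrow>
     multilinear_form m w \<and>
     (\<forall>x. (\<forall>xs. length xs = m - 1 \<longrightarrow> w (x # xs) = 0) \<longrightarrow> x = 0) \<and>
     (\<exists>Q. twists_form m w Q)"

definition Q_form :: "nat \<Rightarrow> (('k::field ^ 'n) list \<Rightarrow> 'k) \<Rightarrow> 'k ^ 'n ^ 'n" where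
  "Q_form m w = (THE Q. twists_form m w Q)"

definition form_coeff :: "(('k::field ^ 'n) list \<Rightarrow> 'k) \<Rightarrow> 'n list \<Rightarrow> 'k" where
  "form_coeff w ls = w (map (\<lambda>l. axis l 1) ls)"

section \<open>The quadratic algebra\<close>

definition quad_rels :: "nat \<Rightarrow> (('k::field ^ 'n) list \<Rightarrow> 'k) \<Rightarrow> ('n::finite list \<Rightarrow>\<^sub>0 'k) set" where
  "quad_rels m w =
     {\<Sum>\<mu>\<in>UNIV. \<Sum>\<nu>\<in>UNIV. Poly_Mapping.single [\<mu>, \<nu>] (form_coeff w (ls @ [\<mu>, \<nu>]))
      | ls. length ls = m - 2}"

definition quad_ideal :: "nat \<Rightarrow> (('k::field ^ 'n) list \<Rightarrow> 'k) \<Rightarrow> ('n::finite list \<Rightarrow>\<^sub>0 'k) set" where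
  "quad_ideal m w = genideal free_alg (quad_rels m w)"

text \<open>
  The map of \<open>free_alg / I\<close> induced by a linear map \<open>h\<close> of \<open>free_alg\<close> with \<open>h ` I \<subseteq> I\<close>;
  the union is then over equal cosets.
\<close>

definition induced_map ::
    "('n list \<Rightarrow>\<^sub>0 'k::field) set \<Rightarrow> (('n list \<Rightarrow>\<^sub>0 'k) \<Rightarrow> ('n list \<Rightarrow>\<^sub>0 'k)) \<Rightarrow>
     ('n list \<Rightarrow>\<^sub>0 'k) set \<Rightarrow> ('n list \<Rightarrow>\<^sub>0 'k) set" where
  "induced_map I h X = (\<Union>f\<in>X. I +>\<^bsub>free_alg\<^esub> h f)"

text \<open>
  A \<open>'k\<close>-algebra is given as a \<^type>\<open>module\<close> record, which carries both the ring
  operations and the multiplication by scalars.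
\<close>

definition quad_alg ::
    "nat \<Rightarrow> (('k::field ^ 'n) list \<Rightarrow> 'k) \<Rightarrow> ('k, ('n::finite list \<Rightarrow>\<^sub>0 'k) set) module" where
  "quad_alg m w =
     ring.extend (free_alg Quot quad_ideal m w)
       (module.fields (\<lambda>c. induced_map (quad_ideal m w) (pscale c)))"

definition quad_gen :: "nat \<Rightarrow> (('k::field ^ 'n) list \<Rightarrow> 'k) \<Rightarrow> 'n::finite \<Rightarrow> ('n list \<Rightarrow>\<^sub>0 'k) set" where
  "quad_gen m w l = quad_ideal m w +>\<^bsub>free_alg\<^esub> Poly_Mapping.single [l] 1"

text \<open>
  The algebra endomorphism of the free algebra with \<open>x\<^sup>\<lambda> \<mapsto> Q\<^sup>\<lambda>\<^sub>\<mu> x\<^sup>\<mu>\<close>. Since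
  \<open>Q e\<^sub>\<mu> = Q\<^sup>\<lambda>\<^sub>\<mu> e\<^sub>\<lambda>\<close>, the number \<open>Q\<^sup>\<lambda>\<^sub>\<mu>\<close> is the matrix entry \<open>Q $ \<lambda> $ \<mu>\<close>.
\<close>

definition free_subst :: "'k::field ^ 'n ^ 'n \<Rightarrow> ('n::finite list \<Rightarrow>\<^sub>0 'k) \<Rightarrow> ('n list \<Rightarrow>\<^sub>0 'k)" where
  "free_subst Q =
     lin_ext (\<lambda>ls. prod_list (map (\<lambda>l. \<Sum>\<mu>\<in>UNIV. Poly_Mapping.single [\<mu>] (Q $ l $ \<mu>)) ls))"

definition sigma :: "nat \<Rightarrow> (('k::field ^ 'n) list \<Rightarrow> 'k) \<Rightarrow>
    ('n::finite list \<Rightarrow>\<^sub>0 'k) set \<Rightarrow> ('n list \<Rightarrow>\<^sub>0 'k) set" where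
  "sigma m w = induced_map (quad_ideal m w) (free_subst (Q_form m w))"

text \<open>The linear map of \<open>\<A>\<close> which is multiplication by \<open>(-1)\<^bsup>(m-1)n\<^esup>\<close> on the degree \<open>n\<close> part.\<close>

definition degree_sign :: "nat \<Rightarrow> (('k::field ^ 'n) list \<Rightarrow> 'k) \<Rightarrow>
    ('n::finite list \<Rightarrow>\<^sub>0 'k) set \<Rightarrow> ('n list \<Rightarrow>\<^sub>0 'k) set" where
  "degree_sign m w =
     induced_map (quad_ideal m w)
       (lin_ext (\<lambda>ls. Poly_Mapping.single ls ((-1) ^ ((m - 1) * length ls))))"

section \<open>Hochschild homology with values in a bimodule\<close>

record ('k, 'a, 'b) bimod = "('k, 'b) module" +
  lact :: "'a \<Rightarrow> 'b \<Rightarrow> 'b"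
  ract :: "'b \<Rightarrow> 'a \<Rightarrow> 'b"

definition twisted_bimod :: "nat \<Rightarrow> (('k::field ^ 'n) list \<Rightarrow> 'k) \<Rightarrow>
    ('k, ('n::finite list \<Rightarrow>\<^sub>0 'k) set, ('n list \<Rightarrow>\<^sub>0 'k) set) bimod" where
  "twisted_bimod m w =
     module.extend (quad_alg m w)
       (bimod.fields
          (\<lambda>a \<xi>. degree_sign m w (inv_into (carrier (quad_alg m w)) (sigma m w) a) \<otimes>\<^bsub>quad_alg m w\<^esub> \<xi>)
          (\<lambda>\<xi> a. \<xi> \<otimes>\<^bsub>quad_alg m w\<^esub> a))"

text \<open>
  \<open>M \<otimes> A\<^bsup>\<otimes>n\<^esup>\<close> is the free vector space on the pairs \<open>(\<xi>, [a\<^sub>1, \<dots>, a\<^sub>n])\<close> modulo the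
  subspace spanned by the multilinearity relations; its elements are cosets.
\<close>

definition tuples :: "('a, 'x) partial_object_scheme \<Rightarrow> nat \<Rightarrow> 'a list set" where
  "tuples A n = {as. set as \<subseteq> carrier A \<and> length as = n}"

definition free_chains :: "('k::field, 'a) module \<Rightarrow> ('k, 'a, 'b) bimod \<Rightarrow> nat \<Rightarrow>
    ('b \<times> 'a list \<Rightarrow>\<^sub>0 'k) set" where
  "free_chains A M n = {f. Poly_Mapping.keys f \<subseteq> carrier M \<times> tuples A n}"

definition tensor_rels :: "('k::field, 'a) module \<Rightarrow> ('k, 'a, 'b) bimod \<Rightarrow> nat \<Rightarrow>
    ('b \<times> 'a list \<Rightarrow>\<^sub>0 'k) set" where
  "tensor_rels A M n = pm.span
     ({Poly_Mapping.single (\<xi> \<oplus>\<^bsub>M\<^esub> \<eta>, as) 1 - Poly_Mapping.single (\<xi>, as) 1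
         - Poly_Mapping.single (\<eta>, as) 1
       | \<xi> \<eta> as. \<xi> \<in> carrier M \<and> \<eta> \<in> carrier M \<and> as \<in> tuples A n} \<union>
      {Poly_Mapping.single (c \<odot>\<^bsub>M\<^esub> \<xi>, as) 1 - Poly_Mapping.single (\<xi>, as) c
       | c \<xi> as. \<xi> \<in> carrier M \<and> as \<in> tuples A n} \<union>
      {Poly_Mapping.single (\<xi>, as @ (a \<oplus>\<^bsub>A\<^esub> a') # bs) 1 - Poly_Mapping.single (\<xi>, as @ a # bs) 1
         - Poly_Mapping.single (\<xi>, as @ a' # bs) 1
       | \<xi> as a a' bs. \<xi> \<in> carrier M \<and> as @ a # bs \<in> tuples A n \<and> a' \<in> carrier A} \<union>
      {Poly_Mapping.single (\<xi>, as @ (c \<odot>\<^bsub>A\<^esub> a) # bs) 1 - Poly_Mapping.single (\<xi>, as @ a # bs) c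
       | c \<xi> as a bs. \<xi> \<in> carrier M \<and> as @ a # bs \<in> tuples A n})"

definition chain_class :: "('k::field, 'a) module \<Rightarrow> ('k, 'a, 'b) bimod \<Rightarrow> nat \<Rightarrow>
    ('b \<times> 'a list \<Rightarrow>\<^sub>0 'k) \<Rightarrow> ('b \<times> 'a list \<Rightarrow>\<^sub>0 'k) set" where
  "chain_class A M n f = (+) f ` tensor_rels A M n"

definition chains :: "('k::field, 'a) module \<Rightarrow> ('k, 'a, 'b) bimod \<Rightarrow> nat \<Rightarrow>
    ('b \<times> 'a list \<Rightarrow>\<^sub>0 'k) set set" where
  "chains A M n = chain_class A M n ` free_chains A M n"

text \<open>
  The boundary of \<open>\<xi> \<otimes> a\<^sub>1 \<otimes> \<dots> \<otimes> a\<^sub>n\<close> for \<open>n \<ge> 1\<close>; here \<open>a\<^sub>k\<close> is \<open>as ! (k - 1)\<close>.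
\<close>

definition boundary_gen :: "('k::field, 'a) module \<Rightarrow> ('k, 'a, 'b) bimod \<Rightarrow>
    'b \<times> 'a list \<Rightarrow> ('b \<times> 'a list \<Rightarrow>\<^sub>0 'k)" where
  "boundary_gen A M = (\<lambda>(\<xi>, as).
     Poly_Mapping.single (ract M \<xi> (hd as), tl as) 1
     + (\<Sum>k = 1..<length as. Poly_Mapping.single
          (\<xi>, take (k - 1) as @ (as ! (k - 1) \<otimes>\<^bsub>A\<^esub> as ! k) # drop (k + 1) as) ((-1) ^ k))
     + Poly_Mapping.single (lact M (last as) \<xi>, butlast as) ((-1) ^ length as))"

text \<open>\<open>boundary A M n\<close> maps \<open>(n+1)\<close>-chains to \<open>n\<close>-chains.\<close>

definition boundary :: "('k::field, 'a) module \<Rightarrow> ('k, 'a, 'b) bimod \<Rightarrow> nat \<Rightarrow>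
    ('b \<times> 'a list \<Rightarrow>\<^sub>0 'k) set \<Rightarrow> ('b \<times> 'a list \<Rightarrow>\<^sub>0 'k) set" where
  "boundary A M n X = (\<Union>f\<in>X. chain_class A M n (lin_ext (boundary_gen A M) f))"

text \<open>The coset \<open>tensor_rels A M n\<close> is the zero of \<open>chains A M n\<close>.\<close>

definition hoch_cycles :: "('k::field, 'a) module \<Rightarrow> ('k, 'a, 'b) bimod \<Rightarrow> nat \<Rightarrow>
    ('b \<times> 'a list \<Rightarrow>\<^sub>0 'k) set set" where
  "hoch_cycles A M n =
     (case n of 0 \<Rightarrow> chains A M 0
      | Suc k \<Rightarrow> {X \<in> chains A M (Suc k). boundary A M k X = tensor_rels A M k})"

definition hoch_boundaries :: "('k::field, 'a) module \<Rightarrow> ('k, 'a, 'b) bimod \<Rightarrow> nat \<Rightarrow>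
    ('b \<times> 'a list \<Rightarrow>\<^sub>0 'k) set set" where
  "hoch_boundaries A M n = boundary A M n ` chains A M (Suc n)"

text \<open>
  \<open>W\<^bsub>\<lambda>\<^sub>1\<dots>\<lambda>\<^sub>m\<^esub> 1 \<otimes> x\<^bsup>\<lambda>\<^sub>1\<^esup> \<otimes> \<cdots> \<otimes> x\<^bsup>\<lambda>\<^sub>m\<^esup>\<close> in \<open>\<^sup>w\<A> \<otimes> \<A>\<^bsup>\<otimes>m\<^esup>\<close>.
\<close>

definition one_tensor :: "nat \<Rightarrow> (('k::field ^ 'n) list \<Rightarrow> 'k) \<Rightarrow>
    (('n::finite list \<Rightarrow>\<^sub>0 'k) set \<times> ('n list \<Rightarrow>\<^sub>0 'k) set list \<Rightarrow>\<^sub>0 'k) set" where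
  "one_tensor m w = chain_class (quad_alg m w) (twisted_bimod m w) m
     (\<Sum>ls | length ls = m.
        Poly_Mapping.single (\<one>\<^bsub>quad_alg m w\<^esub>, map (quad_gen m w) ls) (form_coeff w ls))"

end

theory Submission
  imports Defs
begin

text \<open>
  In \<open>b (1 \<otimes> w)\<close> the inner terms vanish because cyclicity of \<open>w\<close> up to \<open>Q\<close> turns a contraction of
  any two adjacent indices into a combination of the defining relations, and the two outer terms
  cancel because \<open>(\<sigma>\<^sup>w)\<^sup>-\<^sup>1\<close> undoes the twist that moves the last index of \<open>w\<close> to the front.

  For nontriviality choose \<open>\<lambda>\<^sub>1, \<dots>, \<lambda>\<^sub>m\<close> with \<open>W\<^bsub>\<lambda>\<^sub>1\<dots>\<lambda>\<^sub>m\<^esub> \<noteq> 0\<close> and consider the functional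
  \<open>\<xi> \<otimes> a\<^sub>1 \<otimes> \<cdots> \<otimes> a\<^sub>m \<mapsto> \<epsilon>(\<xi>) \<partial>\<^sub>1(a\<^sub>1) \<cdots> \<partial>\<^sub>m(a\<^sub>m)\<close>, where \<open>\<epsilon>\<close> is the
  augmentation and \<open>\<partial>\<^sub>i\<close> takes the coefficient of \<open>x\<^bsup>\<lambda>\<^sub>i\<^esup>\<close>. As \<open>\<partial>\<^sub>i (a b) = \<epsilon>(a) \<partial>\<^sub>i(b) + \<partial>\<^sub>i(a) \<epsilon>(b)\<close>,
  it kills all boundaries by telescoping, but not \<open>1 \<otimes> w\<close>.
\<close>

section \<open>Linear extension and the free algebra\<close>

lemma keys_pscale_subset: "Poly_Mapping.keys (pscale c f) \<subseteq> Poly_Mapping.keys f"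
  by (intro subsetI) (simp add: in_keys_iff)

lemma pscale_single [simp]:
  "pscale c (Poly_Mapping.single x a) = Poly_Mapping.single x (c * a)"
  by (rule poly_mapping_eqI) (simp add: lookup_single when_def)

lemma single_sum:
  "Poly_Mapping.single x (sum c S) = (\<Sum>i\<in>S. Poly_Mapping.single x (c i))"
  by (induction S rule: infinite_finite_induct) (auto simp: single_add)

text \<open>Supports can shrink by cancellation in a sum, so additivity of \<open>lin_ext\<close> is
  obtained by summing over one finite set that contains all supports involved.\<close>

lemma lin_ext_superset:
  assumes "finite S" "Poly_Mapping.keys f \<subseteq> S"
  shows "lin_ext g f = (\<Sum>x\<in>S. pscale (Poly_Mapping.lookup f x) (g x))"
  unfolding lin_ext_def using assms
  by (intro sum.mono_neutral_left) (auto simp: in_keys_iff)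

lemma lin_ext_add: "lin_ext g (f1 + f2) = lin_ext g f1 + lin_ext g f2"
proof -
  let ?S = "Poly_Mapping.keys f1 \<union> Poly_Mapping.keys f2"
  have "lin_ext g f = (\<Sum>x\<in>?S. pscale (Poly_Mapping.lookup f x) (g x))"
    if "Poly_Mapping.keys f \<subseteq> ?S" for f
    using that by (intro lin_ext_superset) auto
  then show ?thesis
    using Poly_Mapping.keys_add[of f1 f2]
    by (simp add: lookup_add pm.scale_left_distrib sum.distrib)
qed

lemma lin_ext_pscale: "lin_ext g (pscale c f) = pscale c (lin_ext g f)"
proof -
  have "lin_ext g (pscale c f)
      = (\<Sum>x\<in>Poly_Mapping.keys f. pscale (Poly_Mapping.lookup (pscale c f) x) (g x))"
    by (intro lin_ext_superset keys_pscale_subset finite_keys)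
  then show ?thesis
    by (simp add: lin_ext_def pm.scale_sum_right)
qed

lemma lin_ext_single [simp]: "lin_ext g (Poly_Mapping.single x c) = pscale c (g x)"
  by (subst lin_ext_superset[of "{x}"]) auto

lemma lin_ext_0 [simp]: "lin_ext g 0 = 0"
  by (simp add: lin_ext_def)

lemma lin_ext_uminus: "lin_ext g (- f) = - lin_ext g f"
  using lin_ext_pscale[of g "- 1" f] by simp

lemma lin_ext_diff: "lin_ext g (f1 - f2) = lin_ext g f1 - lin_ext g f2"
  using lin_ext_add[of g f1 "- f2"] by (simp add: lin_ext_uminus)

lemma lin_ext_sum: "lin_ext g (sum f S) = (\<Sum>i\<in>S. lin_ext g (f i))"
  by (induction S rule: infinite_finite_induct) (auto simp: lin_ext_add)

lemma lin_ext_singles [simp]: "lin_ext (\<lambda>x. Poly_Mapping.single x 1) f = f"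
proof (rule poly_mapping_eqI)
  fix y
  have "Poly_Mapping.lookup (lin_ext (\<lambda>x. Poly_Mapping.single x 1) f) y
      = (\<Sum>x\<in>Poly_Mapping.keys f. if x = y then Poly_Mapping.lookup f x else 0)"
    by (simp add: lin_ext_def lookup_sum lookup_single when_def mult.commute if_distrib cong: if_cong)
  then show "Poly_Mapping.lookup (lin_ext (\<lambda>x. Poly_Mapping.single x 1) f) y
      = Poly_Mapping.lookup f y"
    by (simp add: in_keys_iff)
qed

text \<open>Every finitely supported function is a finite sum of singles with arbitrary
  coefficients, so additivity alone determines a map from its values there. This reduces identities
  in the free algebra to identities between words; the codomain is any abelian group, so it serves
  scalar-valued functionals too.\<close>

lemma additive_eqI:
  fixes h h' :: "('x \<Rightarrow>\<^sub>0 'k::field) \<Rightarrow> 'b::ab_group_add"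
  assumes "\<And>f g. h (f + g) = h f + h g" "\<And>f g. h' (f + g) = h' f + h' g"
    and single: "\<And>x c. h (Poly_Mapping.single x c) = h' (Poly_Mapping.single x c)"
  shows "h f = h' f"
proof -
  interpret h: additive h by standard fact
  interpret h': additive h' by standard fact
  have f: "f = (\<Sum>x\<in>Poly_Mapping.keys f. Poly_Mapping.single x (Poly_Mapping.lookup f x))"
    using lin_ext_singles[of f, unfolded lin_ext_def] by simp
  show ?thesis
    by (subst (1 2) f) (simp add: h.sum h'.sum single)
qed

section \<open>Products and linear substitutions in the free algebra\<close>

lemma pscale_times_left: "pscale c f * g = pscale c (f * g)"
  for f g :: "'n::monoid_add \<Rightarrow>\<^sub>0 'k::field"
proof (rule additive_eqI[where f = f])
  show "pscale c (Poly_Mapping.single x a) * g = pscale c (Poly_Mapping.single x a * g)" for x a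
    by (rule additive_eqI[where f = g])
       (auto simp: mult_single algebra_simps pm.scale_right_distrib)
qed (auto simp: algebra_simps pm.scale_right_distrib)

lemma pscale_times_right: "f * pscale c g = pscale c (f * g)"
  for f g :: "'n::monoid_add \<Rightarrow>\<^sub>0 'k::field"
proof (rule additive_eqI[where f = f])
  show "Poly_Mapping.single x a * pscale c g = pscale c (Poly_Mapping.single x a * g)" for x a
    by (rule additive_eqI[where f = g])
       (auto simp: mult_single algebra_simps pm.scale_right_distrib)
qed (auto simp: algebra_simps pm.scale_right_distrib)

lemma single_word_mult:
  "Poly_Mapping.single xs a * Poly_Mapping.single ys b
     = Poly_Mapping.single (xs @ ys) (a * b :: 'k::field)"
  by (simp add: mult_single plus_list_def)

lemma one_free_alg: "(1 :: 'n list \<Rightarrow>\<^sub>0 'k::field) = Poly_Mapping.single [] 1"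
  by (metis single_one zero_list_def)

text \<open>Both sides are additive in each factor, so two uses of \<open>additive_eqI\<close> leave
  only the product of two words. This is how substitutions and the degree sign become algebra
  endomorphisms.\<close>

lemma lin_ext_mult:
  fixes f g :: "'n list \<Rightarrow>\<^sub>0 'k::field" and h :: "'n list \<Rightarrow> ('p list \<Rightarrow>\<^sub>0 'k)"
  assumes "\<And>xs ys. h (xs @ ys) = h xs * h ys"
  shows "lin_ext h (f * g) = lin_ext h f * lin_ext h g"
proof (rule additive_eqI[where f = f])
  show "lin_ext h (Poly_Mapping.single x a * g) = lin_ext h (Poly_Mapping.single x a) * lin_ext h g"
    for x a
    by (rule additive_eqI[where f = g])
       (auto simp: single_word_mult algebra_simps lin_ext_add assms
          pscale_times_left pscale_times_right)
qed (auto simp: algebra_simps lin_ext_add)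

lemma free_subst_mult: "free_subst P (f * g) = free_subst P f * free_subst P g"
  unfolding free_subst_def by (rule lin_ext_mult) simp

lemma free_subst_generator:
  "free_subst P (Poly_Mapping.single [l] c) = (\<Sum>\<mu>\<in>UNIV. Poly_Mapping.single [\<mu>] (c * P $ l $ \<mu>))"
  by (simp add: free_subst_def pm.scale_sum_right)

lemma free_subst_add: "free_subst P (f + g) = free_subst P f + free_subst P g"
  and free_subst_pscale: "free_subst P (pscale c f) = pscale c (free_subst P f)"
  and free_subst_sum: "free_subst P (sum F S) = (\<Sum>i\<in>S. free_subst P (F i))"
  by (simp_all add: free_subst_def lin_ext_add lin_ext_pscale lin_ext_sum)

text \<open>A generator is sent to a row of the matrix, so composing substitutions multiplies the
  matrices in the opposite order: first \<open>P\<close>, then \<open>P'\<close>, gives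
  \<open>P ** P'\<close>.\<close>

lemma free_subst_inverse:
  assumes "P ** P' = mat 1"
  shows "free_subst P' (free_subst P f) = f"
proof (rule additive_eqI[where f = f])
  have gen: "free_subst P' (free_subst P (Poly_Mapping.single [l] 1)) = Poly_Mapping.single [l] 1" for l
  proof -
    have "free_subst P' (free_subst P (Poly_Mapping.single [l] 1))
        = (\<Sum>\<mu>\<in>UNIV. \<Sum>\<nu>\<in>UNIV. Poly_Mapping.single [\<nu>] (P $ l $ \<mu> * P' $ \<mu> $ \<nu>))"
      by (simp add: free_subst_generator free_subst_sum)
    also have "\<dots> = (\<Sum>\<nu>\<in>UNIV. Poly_Mapping.single [\<nu>] ((P ** P') $ l $ \<nu>))"
      by (subst sum.swap) (simp add: matrix_matrix_mult_def single_sum)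
    also have "\<dots> = (\<Sum>\<nu>\<in>UNIV. if l = \<nu> then Poly_Mapping.single [\<nu>] 1 else 0)"
      unfolding assms by (intro sum.cong) (auto simp: mat_def)
    finally show ?thesis by simp
  qed
  show "free_subst P' (free_subst P (Poly_Mapping.single xs c)) = Poly_Mapping.single xs c" for xs c
  proof (induction xs)
    case Nil
    show ?case by (simp add: free_subst_def one_free_alg)
  next
    case (Cons l xs)
    have "Poly_Mapping.single (l # xs) c = Poly_Mapping.single [l] 1 * Poly_Mapping.single xs c"
      by (simp add: single_word_mult)
    then show ?case by (simp add: free_subst_mult gen Cons)
  qed
qed (auto simp: free_subst_add)

section \<open>The quotient algebra\<close>

definition quad_class ::
    "nat \<Rightarrow> (('k::field ^ 'n) list \<Rightarrow> 'k) \<Rightarrow> ('n::finite list \<Rightarrow>\<^sub>0 'k) \<Rightarrow> ('n list \<Rightarrow>\<^sub>0 'k) set" where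
  "quad_class m w f = quad_ideal m w +>\<^bsub>free_alg\<^esub> f"

lemma carrier_free_alg [simp]: "carrier free_alg = UNIV"
  and free_alg_simps [simp]:
    "monoid.mult free_alg = (*)" "one free_alg = 1" "ring.zero free_alg = 0" "add free_alg = (+)"
  by (simp_all add: free_alg_def)

lemma quad_ideal_ideal: "ideal (quad_ideal m w) free_alg"
  unfolding quad_ideal_def by (rule ring.genideal_ideal[OF free_alg_ring]) simp

lemma quad_ideal_rels: "quad_rels m w \<subseteq> quad_ideal m w"
  unfolding quad_ideal_def by (rule ring.genideal_self[OF free_alg_ring]) simp

lemma quad_ideal_add: "f \<in> quad_ideal m w \<Longrightarrow> g \<in> quad_ideal m w \<Longrightarrow> f + g \<in> quad_ideal m w"
  using additive_subgroup.a_closed[OF ideal.axioms(1)[OF quad_ideal_ideal], of f m w g] by simp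

lemma quad_ideal_0 [simp]: "0 \<in> quad_ideal m w"
  using additive_subgroup.zero_closed[OF ideal.axioms(1)[OF quad_ideal_ideal], of m w] by simp

lemma quad_ideal_mult_left: "f \<in> quad_ideal m w \<Longrightarrow> g * f \<in> quad_ideal m w"
  using ideal.I_l_closed[OF quad_ideal_ideal, of f m w g] by simp

lemma quad_ideal_mult_right: "f \<in> quad_ideal m w \<Longrightarrow> f * g \<in> quad_ideal m w"
  using ideal.I_r_closed[OF quad_ideal_ideal, of f m w g] by simp

lemma quad_ideal_pscale: "f \<in> quad_ideal m w \<Longrightarrow> pscale c f \<in> quad_ideal m w"
  using quad_ideal_mult_left[of f m w "pscale c 1"] by (simp add: pscale_times_left)

lemma quad_ideal_uminus: "f \<in> quad_ideal m w \<Longrightarrow> - f \<in> quad_ideal m w"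
  using quad_ideal_mult_left[of f m w "- 1"] by simp

lemma quad_ideal_diff: "f \<in> quad_ideal m w \<Longrightarrow> g \<in> quad_ideal m w \<Longrightarrow> f - g \<in> quad_ideal m w"
  using quad_ideal_add[of f m w "- g"] quad_ideal_uminus by fastforce

lemma quad_ideal_sum: "(\<And>i. i \<in> S \<Longrightarrow> f i \<in> quad_ideal m w) \<Longrightarrow> sum f S \<in> quad_ideal m w"
  by (induction S rule: infinite_finite_induct) (auto simp: quad_ideal_add)

text \<open>The induction principle for the ideal of relations. Below, \<open>J\<close> is either
  the preimage of the ideal under an endomorphism or a space of elements with vanishing low-degree
  coefficients. Negatives in \<open>J\<close> come from multiplying by \<open>- 1\<close>.\<close>

lemma quad_ideal_minimal:
  assumes "f \<in> quad_ideal m w" and "quad_rels m w \<subseteq> J"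
    and "0 \<in> J" "\<And>f g. f \<in> J \<Longrightarrow> g \<in> J \<Longrightarrow> f + g \<in> J"
    and "\<And>f g. f \<in> J \<Longrightarrow> g * f \<in> J" "\<And>f g. f \<in> J \<Longrightarrow> f * g \<in> J"
  shows "f \<in> J"
proof -
  have neg: "- f \<in> J" if "f \<in> J" for f
    using assms(5)[OF that, of "- 1"] by simp
  interpret R: ring free_alg by (rule free_alg_ring)
  have "subgroup J (add_monoid free_alg)"
  proof (rule group.subgroupI)
    show "Group.group (add_monoid free_alg)" by (rule R.add.is_group)
    fix f assume "f \<in> J"
    moreover have "\<ominus>\<^bsub>free_alg\<^esub> f = - f"
      by (rule R.minus_equality) auto
    ultimately show "inv\<^bsub>add_monoid free_alg\<^esub> f \<in> J"
      using neg by (simp add: a_inv_def)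
  qed (use assms in auto)
  then have "ideal J free_alg"
    using assms by (intro idealI[OF free_alg_ring]) auto
  then show ?thesis
    using ring.genideal_minimal[OF free_alg_ring _ assms(2)] assms(1)
    by (auto simp: quad_ideal_def)
qed

section \<open>Computing with representatives in the quotient\<close>

lemma mem_quad_class: "g \<in> quad_class m w f \<longleftrightarrow> g - f \<in> quad_ideal m w"
proof -
  have "g - f \<in> quad_ideal m w \<Longrightarrow> \<exists>h\<in>quad_ideal m w. g = h + f"
    by (rule bexI[of _ "g - f"]) simp_all
  then show ?thesis
    unfolding quad_class_def a_r_coset_def' by auto
qed

lemma quad_class_eq_iff: "quad_class m w f = quad_class m w g \<longleftrightarrow> f - g \<in> quad_ideal m w"
proof
  assume "quad_class m w f = quad_class m w g"
  then show "f - g \<in> quad_ideal m w"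
    using mem_quad_class[of f m w f] by (simp add: mem_quad_class)
next
  assume fg: "f - g \<in> quad_ideal m w"
  have "h - f \<in> quad_ideal m w \<longleftrightarrow> h - g \<in> quad_ideal m w" for h
    using quad_ideal_add[OF _ fg, of "h - f"] quad_ideal_diff[OF _ fg, of "h - g"]
    by (auto simp: algebra_simps)
  then show "quad_class m w f = quad_class m w g"
    by (auto simp: mem_quad_class)
qed

text \<open>All members of a coset have images in one coset, since their differences are sent into
  the ideal; the union in \<open>induced_map\<close> thus collapses to a single coset.\<close>

lemma induced_map_quad_class:
  assumes diff: "\<And>f g. h (f - g) = h f - h g"
    and I: "\<And>f. f \<in> quad_ideal m w \<Longrightarrow> h f \<in> quad_ideal m w"
  shows "induced_map (quad_ideal m w) h (quad_class m w f) = quad_class m w (h f)"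
proof -
  have "quad_class m w (h g) = quad_class m w (h f)" if "g \<in> quad_class m w f" for g
    using I[of "g - f"] that by (simp add: mem_quad_class quad_class_eq_iff diff)
  moreover have "f \<in> quad_class m w f" by (simp add: mem_quad_class)
  ultimately show ?thesis
    unfolding induced_map_def quad_class_def[symmetric] by blast
qed

lemma quad_alg_sel:
  "carrier (quad_alg m w) = carrier (free_alg Quot quad_ideal m w)"
  "monoid.mult (quad_alg m w) = monoid.mult (free_alg Quot quad_ideal m w)"
  "one (quad_alg m w) = one (free_alg Quot quad_ideal m w)"
  "add (quad_alg m w) = add (free_alg Quot quad_ideal m w)"
  "smult (quad_alg m w) = (\<lambda>c. induced_map (quad_ideal m w) (pscale c))"
  by (simp_all add: quad_alg_def ring.defs module.defs)

lemma carrier_quad_alg: "carrier (quad_alg m w) = range (quad_class m w)"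
  by (auto simp: quad_alg_sel FactRing_def A_RCOSETS_def' quad_class_def)

lemma quad_class_closed [simp]: "quad_class m w f \<in> carrier (quad_alg m w)"
  by (simp add: carrier_quad_alg)

lemma quad_alg_mult [simp]:
  "quad_class m w f \<otimes>\<^bsub>quad_alg m w\<^esub> quad_class m w g = quad_class m w (f * g)"
  using ideal.rcoset_mult_add[OF quad_ideal_ideal, of f g m w]
  by (simp add: quad_alg_sel FactRing_def quad_class_def)

lemma quad_alg_add [simp]:
  "quad_class m w f \<oplus>\<^bsub>quad_alg m w\<^esub> quad_class m w g = quad_class m w (f + g)"
  using ideal.a_rcos_sum[OF quad_ideal_ideal, of f g m w]
  by (simp add: quad_alg_sel FactRing_def quad_class_def)

lemma quad_alg_one: "\<one>\<^bsub>quad_alg m w\<^esub> = quad_class m w 1"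
  by (simp add: quad_alg_sel FactRing_def quad_class_def)

lemma quad_alg_smult [simp]: "c \<odot>\<^bsub>quad_alg m w\<^esub> quad_class m w f = quad_class m w (pscale c f)"
  by (simp add: quad_alg_sel induced_map_quad_class pm.scale_right_diff_distrib quad_ideal_pscale)

lemma quad_gen_eq: "quad_gen m w l = quad_class m w (Poly_Mapping.single [l] 1)"
  by (simp add: quad_gen_def quad_class_def)

section \<open>The twisted bimodule and the degree sign\<close>

lemma twisted_bimod_sel:
  "carrier (twisted_bimod m w) = carrier (quad_alg m w)"
  "add (twisted_bimod m w) = add (quad_alg m w)"
  "smult (twisted_bimod m w) = smult (quad_alg m w)"
  "ract (twisted_bimod m w) = monoid.mult (quad_alg m w)"
  "lact (twisted_bimod m w) a \<xi> = degree_sign m w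
     (inv_into (carrier (quad_alg m w)) (sigma m w) a) \<otimes>\<^bsub>quad_alg m w\<^esub> \<xi>"
  by (simp_all add: twisted_bimod_def bimod.defs module.defs)

text \<open>The lift of \<open>degree_sign\<close> to the free algebra. Its exponent is additive in
  the word length, so it is multiplicative.\<close>

definition sign_subst :: "nat \<Rightarrow> ('n list \<Rightarrow>\<^sub>0 'k::field) \<Rightarrow> ('n list \<Rightarrow>\<^sub>0 'k)" where
  "sign_subst m = lin_ext (\<lambda>ls. Poly_Mapping.single ls ((-1) ^ ((m - 1) * length ls)))"

lemma sign_subst_mult: "sign_subst m (f * g) = sign_subst m f * sign_subst m g"
  unfolding sign_subst_def
  by (rule lin_ext_mult) (simp add: single_word_mult power_add distrib_left)

lemma sign_subst_add: "sign_subst m (f + g) = sign_subst m f + sign_subst m g"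
  and sign_subst_diff: "sign_subst m (f - g) = sign_subst m f - sign_subst m g"
  and sign_subst_pscale: "sign_subst m (pscale c f) = pscale c (sign_subst m f)"
  and sign_subst_sum: "sign_subst m (sum F S) = (\<Sum>i\<in>S. sign_subst m (F i))"
  and sign_subst_single: "sign_subst m (Poly_Mapping.single ls c)
     = Poly_Mapping.single ls (c * (-1) ^ ((m - 1) * length ls))"
  by (simp_all add: sign_subst_def lin_ext_add lin_ext_diff lin_ext_pscale lin_ext_sum)

lemma sign_subst_quad_ideal:
  assumes "f \<in> quad_ideal m w" shows "sign_subst m f \<in> quad_ideal m w"
proof -
  have "f \<in> {f. sign_subst m f \<in> quad_ideal m w}"
  proof (rule quad_ideal_minimal[OF assms])
    \<comment> \<open>The relations are homogeneous of degree 2, where the sign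
      \<open>(-1) ^ ((m - 1) * 2)\<close> is 1.\<close>
    have "sign_subst m f = f" if "f \<in> quad_rels m w" for f
    proof -
      from that obtain ls where "f = (\<Sum>\<mu>\<in>UNIV. \<Sum>\<nu>\<in>UNIV.
          Poly_Mapping.single [\<mu>, \<nu>] (form_coeff w (ls @ [\<mu>, \<nu>])))"
        unfolding quad_rels_def by blast
      then show ?thesis by (simp only: sign_subst_sum sign_subst_single) simp
    qed
    then show "quad_rels m w \<subseteq> {f. sign_subst m f \<in> quad_ideal m w}"
      using quad_ideal_rels[of m w] by (simp add: subset_iff)
  qed (auto simp: sign_subst_mult sign_subst_add quad_ideal_add quad_ideal_mult_left
        quad_ideal_mult_right, auto simp: sign_subst_def)
  then show ?thesis by simp
qed

lemma degree_sign_quad_class: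
  "degree_sign m w (quad_class m w f) = quad_class m w (sign_subst m f)"
  unfolding degree_sign_def sign_subst_def[symmetric]
  by (rule induced_map_quad_class) (auto simp: sign_subst_diff sign_subst_quad_ideal)

section \<open>Multilinear forms and the twist\<close>

abbreviation basis_vec :: "'n::finite \<Rightarrow> 'k::field ^ 'n" where
  "basis_vec l \<equiv> axis l 1"

lemma matrix_vector_mult_basis_vec:
  "P *v basis_vec l = (\<Sum>\<mu>\<in>UNIV. P $ \<mu> $ l *s basis_vec \<mu>)" for P :: "'k::field ^ 'n ^ 'n::finite"
proof -
  have "(P *v basis_vec l) $ \<mu> = P $ \<mu> $ l" for \<mu>
    by (simp add: matrix_vector_mult_def axis_def if_distrib cong: if_cong)
  then show ?thesis
    using basis_expansion[of "P *v basis_vec l"] by (simp only:)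
qed

lemma sum_swap_pairs:
  "(\<Sum>a\<in>A. \<Sum>b\<in>B. \<Sum>c\<in>C. \<Sum>d\<in>D. f a b c d)
     = (\<Sum>c\<in>C. \<Sum>d\<in>D. \<Sum>a\<in>A. \<Sum>b\<in>B. f a b c d)"
  for f :: "'a \<Rightarrow> 'b \<Rightarrow> 'c \<Rightarrow> 'd \<Rightarrow> 'e::comm_monoid_add"
proof -
  have "(\<Sum>a\<in>A. \<Sum>b\<in>B. \<Sum>c\<in>C. \<Sum>d\<in>D. f a b c d) = (\<Sum>c\<in>C. \<Sum>a\<in>A. \<Sum>b\<in>B. \<Sum>d\<in>D. f a b c d)"
    by (rule trans[OF sum.cong[OF refl sum.swap] sum.swap])
  also have "\<dots> = (\<Sum>c\<in>C. \<Sum>d\<in>D. \<Sum>a\<in>A. \<Sum>b\<in>B. f a b c d)"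
    by (rule sum.cong[OF refl], rule trans[OF sum.cong[OF refl sum.swap] sum.swap])
  finally show ?thesis .
qed

locale preregular_form =
  fixes m :: nat and w :: "('k::field ^ 'n::finite) list \<Rightarrow> 'k"
  assumes m_ge_2: "m \<ge> 2" and prereg: "preregular m w"
begin

lemma slot_linear:
  "length xs + 1 + length ys = m \<Longrightarrow> Vector_Spaces.linear (*s) (*) (\<lambda>v. w (xs @ v # ys))"
  using prereg by (auto simp: preregular_def multilinear_form_def)

lemma form_sum:
  assumes "length xs + 1 + length ys = m"
  shows "w (xs @ (\<Sum>i\<in>S. c i *s v i) # ys) = (\<Sum>i\<in>S. c i * w (xs @ v i # ys))"
proof -
  interpret L: Vector_Spaces.linear "(*s)" "(*)" "\<lambda>v. w (xs @ v # ys)"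
    by (rule slot_linear[OF assms])
  show ?thesis by (simp add: L.sum L.scale)
qed

lemma form_expand:
  assumes "length xs + 1 + length ys = m"
  shows "w (xs @ u # ys) = (\<Sum>l\<in>UNIV. u $ l * w (xs @ basis_vec l # ys))"
  using form_sum[OF assms, of "\<lambda>l. u $ l" basis_vec UNIV] by (simp add: basis_expansion)

text \<open>The mixed argument list makes the induction run: the last arbitrary vector is expanded
  in the basis and its basis vectors join the block on the right.\<close>

lemma form_eq_0:
  assumes "\<And>ls. length ls = m \<Longrightarrow> form_coeff w ls = 0"
    and "length us + length ls = m"
  shows "w (us @ map basis_vec ls) = 0"
  using assms(2)
proof (induction us arbitrary: ls rule: rev_induct)
  case Nil
  then show ?case using assms(1) by (simp add: form_coeff_def)
next
  case (snoc u us)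
  then have "w (us @ basis_vec l # map basis_vec ls) = 0" for l
    using snoc.IH[of "l # ls"] by simp
  then show ?case
    using form_expand[of us "map basis_vec ls" u] snoc.prems by simp
qed

text \<open>If all coefficients vanished, so would \<open>w\<close> on all lists of length
  \<open>m\<close>, and nondegeneracy in the first slot would make a basis vector zero. The index
  found here later selects the functional that detects the cycle.\<close>

lemma form_coeff_nonzero:
  obtains ls where "length ls = m" "form_coeff w ls \<noteq> 0"
proof -
  have "\<exists>ls. length ls = m \<and> form_coeff w ls \<noteq> 0"
  proof (rule ccontr)
    assume "\<not> ?thesis"
    then have "w xs = 0" if "length xs = m" for xs
      using form_eq_0[of xs "[]"] that by auto
    moreover have "\<forall>x. (\<forall>xs. length xs = m - 1 \<longrightarrow> w (x # xs) = 0) \<longrightarrow> x = 0"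
      using prereg by (simp add: preregular_def)
    ultimately have "basis_vec undefined = (0 :: 'k ^ 'n)"
      using m_ge_2 by auto
    then show False by (simp add: axis_eq_0_iff)
  qed
  then show thesis using that by blast
qed

text \<open>The defining relations have basis vectors in the first \<open>m - 2\<close> slots.
  Multilinearity writes a contraction with arbitrary vectors \<open>us\<close> there as a
  combination of them; this generality is what rotating \<open>w\<close> calls for, since rotation
  places vectors \<open>Q *v basis_vec l\<close> in front.\<close>

lemma quad_ideal_form:
  assumes "length us + length ls = m - 2"
  shows "(\<Sum>\<mu>\<in>UNIV. \<Sum>\<nu>\<in>UNIV. Poly_Mapping.single [\<mu>, \<nu>]
           (w (us @ map basis_vec ls @ [basis_vec \<mu>, basis_vec \<nu>]))) \<in> quad_ideal m w"
  using assms
proof (induction us arbitrary: ls rule: rev_induct)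
  case Nil
  then have "(\<Sum>\<mu>\<in>UNIV. \<Sum>\<nu>\<in>UNIV. Poly_Mapping.single [\<mu>, \<nu>]
           (w (map basis_vec ls @ [basis_vec \<mu>, basis_vec \<nu>]))) \<in> quad_rels m w"
    by (auto simp: quad_rels_def form_coeff_def)
  then show ?case using quad_ideal_rels by (auto simp: subset_iff)
next
  case (snoc u us)
  let ?R = "\<lambda>l. \<Sum>\<mu>\<in>UNIV. \<Sum>\<nu>\<in>UNIV. Poly_Mapping.single [\<mu>, \<nu>]
           (w (us @ map basis_vec (l # ls) @ [basis_vec \<mu>, basis_vec \<nu>]))"
  have "w (us @ u # map basis_vec ls @ [basis_vec \<mu>, basis_vec \<nu>])
      = (\<Sum>l\<in>UNIV. u $ l * w (us @ basis_vec l # map basis_vec ls @ [basis_vec \<mu>, basis_vec \<nu>]))"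
    for \<mu> \<nu>
    using snoc.prems m_ge_2 by (intro form_expand) simp
  then have "(\<Sum>\<mu>\<in>UNIV. \<Sum>\<nu>\<in>UNIV. Poly_Mapping.single [\<mu>, \<nu>]
           (w ((us @ [u]) @ map basis_vec ls @ [basis_vec \<mu>, basis_vec \<nu>])))
      = (\<Sum>\<mu>\<in>UNIV. \<Sum>\<nu>\<in>UNIV. \<Sum>l\<in>UNIV. pscale (u $ l) (Poly_Mapping.single [\<mu>, \<nu>]
           (w (us @ map basis_vec (l # ls) @ [basis_vec \<mu>, basis_vec \<nu>]))))"
    by (simp add: single_sum)
  also have "\<dots> = (\<Sum>l\<in>UNIV. \<Sum>\<mu>\<in>UNIV. \<Sum>\<nu>\<in>UNIV. pscale (u $ l) (Poly_Mapping.single [\<mu>, \<nu>]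
           (w (us @ map basis_vec (l # ls) @ [basis_vec \<mu>, basis_vec \<nu>]))))"
    by (rule trans[OF sum.cong[OF refl sum.swap] sum.swap])
  also have "\<dots> = (\<Sum>l\<in>UNIV. pscale (u $ l) (?R l))"
    by (simp only: pm.scale_sum_right)
  also have "\<dots> \<in> quad_ideal m w"
    using snoc.prems by (intro quad_ideal_sum quad_ideal_pscale snoc.IH) simp
  finally show ?case .
qed

text \<open>In the first slot \<open>w\<close> kills \<open>P *v x - P' *v x\<close>, which is
  therefore 0 by nondegeneracy. This is what gives \<open>THE\<close> in \<open>Q_form\<close> a
  meaning.\<close>

lemma twists_form_unique:
  assumes "twists_form m w P" "twists_form m w P'"
  shows "P = P'"
proof -
  have "P *v x - P' *v x = 0" for x
  proof -
    have "w ((P *v x - P' *v x) # xs) = 0" if "length xs = m - 1" for xs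
    proof -
      interpret L: Vector_Spaces.linear "(*s)" "(*)" "\<lambda>v. w (v # xs)"
        using slot_linear[of "[]" xs] that m_ge_2 by simp
      show ?thesis using assms that by (metis L.diff right_minus_eq twists_form_def)
    qed
    then show ?thesis using prereg unfolding preregular_def by blast
  qed
  then show ?thesis by (simp add: matrix_eq)
qed

section \<open>The twisting matrix and cyclic rotation\<close>

definition Q :: "'k ^ 'n ^ 'n" where "Q = Q_form m w"

lemma Q_twists: "twists_form m w Q"
proof -
  obtain P where "twists_form m w P"
    using prereg by (auto simp: preregular_def)
  then show ?thesis
    unfolding Q_def Q_form_def by (rule theI) (rule twists_form_unique[OF _ \<open>twists_form m w P\<close>])
qed

definition Q' :: "'k ^ 'n ^ 'n" where "Q' = matrix_inv Q"

lemma Q_inverse: "Q ** Q' = mat 1" "Q' ** Q = mat 1"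
  using Q_twists someI_ex[of "\<lambda>P. Q ** P = mat 1 \<and> P ** Q = mat 1"]
  by (auto simp: twists_form_def Q'_def invertible_def matrix_inv_def)

lemma Q_mult_Q' [simp]: "Q *v (Q' *v x) = x" and Q'_mult_Q [simp]: "Q' *v (Q *v x) = x"
  by (simp_all add: matrix_vector_mul_assoc Q_inverse)

text \<open>Each use of the twist carries the last vector to the front and applies \<open>Q\<close>
  to it once; the vectors of \<open>p\<close> never pass the end and stay as they are.\<close>

lemma form_rotate: "length p + length q = m \<Longrightarrow> w (p @ q) = w (map ((*v) Q) q @ p)"
proof (induction q arbitrary: p rule: rev_induct)
  case (snoc x q)
  then have "w (p @ q @ [x]) = w ((Q *v x # p) @ q)"
    using Q_twists by (simp add: twists_form_def flip: append_assoc)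
  also have "\<dots> = w (map ((*v) Q) q @ Q *v x # p)"
    using snoc.prems by (intro snoc.IH) simp
  finally show ?case by simp
qed simp

text \<open>A full rotation returns every vector to its place after one application of
  \<open>Q\<close>.\<close>

lemma form_Q_invariant: "length xs = m \<Longrightarrow> w (map ((*v) Q) xs) = w xs"
  using form_rotate[of "[]" xs] by simp

lemma form_Q'_invariant:
  assumes "length xs = m" shows "w (map ((*v) Q') xs) = w xs"
  using form_Q_invariant[of "map ((*v) Q') xs"] assms by (simp add: o_def)

text \<open>Rotating \<open>q\<close> to the front brings the adjacent pair into the last two slots,
  at the price of \<open>Q\<close> acting on the vectors from \<open>q\<close>, which
  \<open>quad_ideal_form\<close> allows.\<close>

lemma quad_ideal_adjacent:
  assumes "length p + length q = m - 2"
  shows "(\<Sum>\<mu>\<in>UNIV. \<Sum>\<nu>\<in>UNIV. Poly_Mapping.single [\<mu>, \<nu>] (form_coeff w (p @ \<mu> # \<nu> # q)))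
    \<in> quad_ideal m w"
proof -
  have "form_coeff w (p @ \<mu> # \<nu> # q)
      = w (map (\<lambda>l. Q *v basis_vec l) q @ map basis_vec p @ [basis_vec \<mu>, basis_vec \<nu>])" for \<mu> \<nu>
    using form_rotate[of "map basis_vec (p @ [\<mu>, \<nu>])" "map basis_vec q"] assms m_ge_2
    by (simp add: form_coeff_def o_def)
  then show ?thesis
    using quad_ideal_form[of "map (\<lambda>l. Q *v basis_vec l) q" p] assms by simp
qed

text \<open>Substituting in a relation applies \<open>P\<close> to the last two arguments of
  \<open>w\<close>. By invariance this equals applying \<open>P'\<close> to the first
  \<open>m - 2\<close> arguments instead, which is again a contraction covered by
  \<open>quad_ideal_form\<close>. The pair of matrices is kept general so as to serve for
  \<open>Q\<close> and for its inverse.\<close>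

lemma free_subst_quad_ideal:
  assumes inv: "\<And>xs. length xs = m \<Longrightarrow> w (map ((*v) P) xs) = w xs"
    and P: "\<And>x. P *v (P' *v x) = x"
    and f: "f \<in> quad_ideal m w"
  shows "free_subst P f \<in> quad_ideal m w"
proof -
  have rel: "free_subst P (\<Sum>\<mu>\<in>UNIV. \<Sum>\<nu>\<in>UNIV.
      Poly_Mapping.single [\<mu>, \<nu>] (form_coeff w (ls @ [\<mu>, \<nu>]))) \<in> quad_ideal m w"
    if ls: "length ls = m - 2" for ls
  proof -
    let ?W = "\<lambda>\<mu> \<nu>. form_coeff w (ls @ [\<mu>, \<nu>])"
    let ?e = "map basis_vec ls"
    have len: "length ls + 2 = m" using ls m_ge_2 by simp
    have word: "free_subst P (Poly_Mapping.single [\<mu>, \<nu>] c)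
        = (\<Sum>\<alpha>\<in>UNIV. \<Sum>\<beta>\<in>UNIV. Poly_Mapping.single [\<alpha>, \<beta>] (P $ \<mu> $ \<alpha> * (P $ \<nu> $ \<beta> * c)))" for \<mu> \<nu> c
    proof -
      have "Poly_Mapping.single [\<mu>, \<nu>] c = Poly_Mapping.single [\<mu>] 1 * Poly_Mapping.single [\<nu>] c"
        by (simp add: single_word_mult)
      then show ?thesis
        by (simp only: free_subst_mult free_subst_generator)
           (simp add: sum_product single_word_mult mult_ac)
    qed
    \<comment> \<open>\<open>P $ \<mu> $ \<alpha>\<close> is the coordinate \<mu> of the image of
      the basis vector \<alpha>, so the double sum is the basis expansion of \<open>w\<close> at two
      image vectors.\<close>
    have coeff: "(\<Sum>\<mu>\<in>UNIV. \<Sum>\<nu>\<in>UNIV. P $ \<mu> $ \<alpha> * (P $ \<nu> $ \<beta> * ?W \<mu> \<nu>))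
        = w (map ((*v) P') ?e @ [basis_vec \<alpha>, basis_vec \<beta>])" for \<alpha> \<beta>
    proof -
      have "w (map ((*v) P') ?e @ [basis_vec \<alpha>, basis_vec \<beta>])
          = w (?e @ P *v basis_vec \<alpha> # [P *v basis_vec \<beta>])"
        using inv[of "map ((*v) P') ?e @ [basis_vec \<alpha>, basis_vec \<beta>]"] len P by (simp add: o_def)
      also have "\<dots> = (\<Sum>\<mu>\<in>UNIV. P $ \<mu> $ \<alpha> * w ((?e @ [basis_vec \<mu>]) @ P *v basis_vec \<beta> # []))"
        using len by (subst (1) matrix_vector_mult_basis_vec, subst form_sum) auto
      also have "\<dots> = (\<Sum>\<mu>\<in>UNIV. P $ \<mu> $ \<alpha> * (\<Sum>\<nu>\<in>UNIV. P $ \<nu> $ \<beta> * ?W \<mu> \<nu>))"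
        using len by (subst matrix_vector_mult_basis_vec, subst form_sum) (auto simp: form_coeff_def)
      finally show ?thesis by (simp add: sum_distrib_left)
    qed
    have "free_subst P (\<Sum>\<mu>\<in>UNIV. \<Sum>\<nu>\<in>UNIV. Poly_Mapping.single [\<mu>, \<nu>] (?W \<mu> \<nu>))
        = (\<Sum>\<mu>\<in>UNIV. \<Sum>\<nu>\<in>UNIV. \<Sum>\<alpha>\<in>UNIV. \<Sum>\<beta>\<in>UNIV.
            Poly_Mapping.single [\<alpha>, \<beta>] (P $ \<mu> $ \<alpha> * (P $ \<nu> $ \<beta> * ?W \<mu> \<nu>)))"
      by (simp only: free_subst_sum word)
    also have "\<dots> = (\<Sum>\<alpha>\<in>UNIV. \<Sum>\<beta>\<in>UNIV. \<Sum>\<mu>\<in>UNIV. \<Sum>\<nu>\<in>UNIV.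
            Poly_Mapping.single [\<alpha>, \<beta>] (P $ \<mu> $ \<alpha> * (P $ \<nu> $ \<beta> * ?W \<mu> \<nu>)))"
      by (rule sum_swap_pairs)
    also have "\<dots> = (\<Sum>\<alpha>\<in>UNIV. \<Sum>\<beta>\<in>UNIV. Poly_Mapping.single [\<alpha>, \<beta>]
        (w (map ((*v) P') ?e @ [basis_vec \<alpha>, basis_vec \<beta>])))"
      by (simp only: single_sum flip: coeff)
    also have "\<dots> \<in> quad_ideal m w"
      using quad_ideal_form[of "map ((*v) P') ?e" "[]"] ls by simp
    finally show ?thesis .
  qed
  have "f \<in> {f. free_subst P f \<in> quad_ideal m w}"
  proof (rule quad_ideal_minimal[OF f])
    show "quad_rels m w \<subseteq> {f. free_subst P f \<in> quad_ideal m w}"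
      using rel by (auto simp: quad_rels_def)
  qed (auto simp: free_subst_mult free_subst_add quad_ideal_add quad_ideal_mult_left
        quad_ideal_mult_right, auto simp: free_subst_def)
  then show ?thesis by simp
qed

lemma free_subst_Q_quad_ideal: "f \<in> quad_ideal m w \<Longrightarrow> free_subst Q f \<in> quad_ideal m w"
  using form_Q_invariant Q_mult_Q' by (rule free_subst_quad_ideal)

lemma free_subst_Q'_quad_ideal: "f \<in> quad_ideal m w \<Longrightarrow> free_subst Q' f \<in> quad_ideal m w"
  using form_Q'_invariant Q'_mult_Q by (rule free_subst_quad_ideal)

lemma free_subst_diff: "free_subst P (f - g) = free_subst P f - free_subst P g"
  by (simp add: free_subst_def lin_ext_diff)

lemma sigma_quad_class: "sigma m w (quad_class m w f) = quad_class m w (free_subst Q f)"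
  unfolding sigma_def Q_def[symmetric]
  by (rule induced_map_quad_class) (auto simp: free_subst_diff free_subst_Q_quad_ideal)

text \<open>Substitution by \<open>Q'\<close> also preserves the ideal, so it descends to a
  two-sided inverse of \<open>sigma\<close>. Injectivity on the carrier then identifies the choice
  made by \<open>inv_into\<close>.\<close>

lemma inv_sigma_quad_class:
  "inv_into (carrier (quad_alg m w)) (sigma m w) (quad_class m w f) = quad_class m w (free_subst Q' f)"
proof (rule inv_into_f_eq)
  show "inj_on (sigma m w) (carrier (quad_alg m w))"
  proof (rule inj_onI)
    fix a b
    assume "a \<in> carrier (quad_alg m w)" "b \<in> carrier (quad_alg m w)" and eq: "sigma m w a = sigma m w b"
    then obtain f g where ab: "a = quad_class m w f" "b = quad_class m w g"
      by (auto simp: carrier_quad_alg)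
    with eq have "free_subst Q (f - g) \<in> quad_ideal m w"
      by (simp add: sigma_quad_class quad_class_eq_iff free_subst_diff)
    then have "free_subst Q' (free_subst Q (f - g)) \<in> quad_ideal m w"
      by (rule free_subst_Q'_quad_ideal)
    then show "a = b"
      by (simp add: ab quad_class_eq_iff free_subst_inverse Q_inverse)
  qed
  show "sigma m w (quad_class m w (free_subst Q' f)) = quad_class m w f"
    by (simp add: sigma_quad_class free_subst_inverse Q_inverse)
qed simp

lemma lact_quad_class:
  "lact (twisted_bimod m w) (quad_class m w f) (quad_class m w g)
     = quad_class m w (sign_subst m (free_subst Q' f) * g)"
  by (simp add: twisted_bimod_sel inv_sigma_quad_class degree_sign_quad_class)

end

section \<open>Chains and the boundary map\<close>

text \<open>Linearity of the induced map into the quotient by \<open>T\<close>, phrased on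
  representatives so that tensors can be handled inside the free space of formal
  combinations.\<close>

definition linear_mod ::
    "('k::field, 'b, 'z) module_scheme \<Rightarrow> ('y \<Rightarrow>\<^sub>0 'k) set \<Rightarrow> ('b \<Rightarrow> ('y \<Rightarrow>\<^sub>0 'k)) \<Rightarrow> bool" where
  "linear_mod V T G \<longleftrightarrow>
     (\<forall>u\<in>carrier V. \<forall>v\<in>carrier V. G (u \<oplus>\<^bsub>V\<^esub> v) - G u - G v \<in> T) \<and>
     (\<forall>c. \<forall>u\<in>carrier V. G (c \<odot>\<^bsub>V\<^esub> u) - pscale c (G u) \<in> T)"

definition linear_between ::
    "('k, 'b, 'z) module_scheme \<Rightarrow> ('k, 'c, 'y) module_scheme \<Rightarrow> ('b \<Rightarrow> 'c) \<Rightarrow> bool" where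
  "linear_between V V' L \<longleftrightarrow>
     (\<forall>u\<in>carrier V. L u \<in> carrier V') \<and>
     (\<forall>u\<in>carrier V. \<forall>v\<in>carrier V. L (u \<oplus>\<^bsub>V\<^esub> v) = L u \<oplus>\<^bsub>V'\<^esub> L v) \<and>
     (\<forall>c. \<forall>u\<in>carrier V. L (c \<odot>\<^bsub>V\<^esub> u) = c \<odot>\<^bsub>V'\<^esub> L u)"

lemma linear_mod_compose:
  "linear_mod V' T G \<Longrightarrow> linear_between V V' L \<Longrightarrow> linear_mod V T (\<lambda>u. G (L u))"
  by (simp add: linear_mod_def linear_between_def)

lemma linear_mod_add:
  assumes T: "pm.subspace T" and "linear_mod V T G" "linear_mod V T G'"
  shows "linear_mod V T (\<lambda>u. G u + G' u)"
  unfolding linear_mod_def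
proof (intro conjI ballI allI)
  fix u v assume "u \<in> carrier V" "v \<in> carrier V"
  then have "(G (u \<oplus>\<^bsub>V\<^esub> v) - G u - G v) + (G' (u \<oplus>\<^bsub>V\<^esub> v) - G' u - G' v) \<in> T"
    using assms by (intro pm.subspace_add[OF T]) (auto simp: linear_mod_def)
  then show "G (u \<oplus>\<^bsub>V\<^esub> v) + G' (u \<oplus>\<^bsub>V\<^esub> v) - (G u + G' u) - (G v + G' v) \<in> T"
    by (simp add: algebra_simps)
next
  fix c u assume "u \<in> carrier V"
  then have "(G (c \<odot>\<^bsub>V\<^esub> u) - pscale c (G u)) + (G' (c \<odot>\<^bsub>V\<^esub> u) - pscale c (G' u)) \<in> T"
    using assms by (intro pm.subspace_add[OF T]) (auto simp: linear_mod_def)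
  then show "G (c \<odot>\<^bsub>V\<^esub> u) + G' (c \<odot>\<^bsub>V\<^esub> u) - pscale c (G u + G' u) \<in> T"
    by (simp add: algebra_simps pm.scale_right_distrib)
qed

lemma linear_mod_pscale:
  assumes T: "pm.subspace T" and "linear_mod V T G"
  shows "linear_mod V T (\<lambda>u. pscale d (G u))"
  unfolding linear_mod_def
proof (intro conjI ballI allI)
  fix u v assume "u \<in> carrier V" "v \<in> carrier V"
  then have "pscale d (G (u \<oplus>\<^bsub>V\<^esub> v) - G u - G v) \<in> T"
    using assms by (intro pm.subspace_scale[OF T]) (auto simp: linear_mod_def)
  then show "pscale d (G (u \<oplus>\<^bsub>V\<^esub> v)) - pscale d (G u) - pscale d (G v) \<in> T"
    by (simp add: pm.scale_right_diff_distrib)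
next
  fix c u assume "u \<in> carrier V"
  then have "pscale d (G (c \<odot>\<^bsub>V\<^esub> u) - pscale c (G u)) \<in> T"
    using assms by (intro pm.subspace_scale[OF T]) (auto simp: linear_mod_def)
  then show "pscale d (G (c \<odot>\<^bsub>V\<^esub> u)) - pscale c (pscale d (G u)) \<in> T"
    by (simp add: pm.scale_right_diff_distrib mult.commute)
qed

lemma linear_mod_sum:
  assumes T: "pm.subspace T" and "\<And>i. i \<in> S \<Longrightarrow> linear_mod V T (G i)"
  shows "linear_mod V T (\<lambda>u. \<Sum>i\<in>S. G i u)"
  using assms(2)
proof (induction S rule: infinite_finite_induct)
  case (insert i S)
  then show ?case using linear_mod_add[OF T, of V "G i" "\<lambda>u. \<Sum>i\<in>S. G i u"] by simp
qed (auto simp: linear_mod_def pm.subspace_0[OF T])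

section \<open>Tensor relations and their universal property\<close>

lemma tuples_append: "as @ bs \<in> tuples A n \<longleftrightarrow>
    set as \<subseteq> carrier A \<and> set bs \<subseteq> carrier A \<and> length as + length bs = n"
  by (auto simp: tuples_def)

lemma subspace_tensor_rels: "pm.subspace (tensor_rels A M n)"
  unfolding tensor_rels_def by (rule pm.subspace_span)

lemma linear_mod_coeff:
  assumes "as \<in> tuples A n"
  shows "linear_mod M (tensor_rels A M n) (\<lambda>\<xi>. Poly_Mapping.single (\<xi>, as) 1)"
  unfolding linear_mod_def tensor_rels_def using assms
  by (intro conjI ballI allI pm.span_base) auto

lemma linear_mod_slot:
  assumes "\<xi> \<in> carrier M" "set as \<subseteq> carrier A" "set bs \<subseteq> carrier A" "length as + Suc (length bs) = n"
  shows "linear_mod A (tensor_rels A M n) (\<lambda>a. Poly_Mapping.single (\<xi>, as @ a # bs) 1)"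
  unfolding linear_mod_def
proof (intro conjI ballI allI)
  fix a a' assume "a \<in> carrier A" "a' \<in> carrier A"
  moreover from this have "as @ a # bs \<in> tuples A n"
    using assms by (simp add: tuples_append)
  ultimately show "Poly_Mapping.single (\<xi>, as @ (a \<oplus>\<^bsub>A\<^esub> a') # bs) 1
      - Poly_Mapping.single (\<xi>, as @ a # bs) 1 - Poly_Mapping.single (\<xi>, as @ a' # bs) 1
      \<in> tensor_rels A M n"
    unfolding tensor_rels_def using assms(1) by (intro pm.span_base) blast
next
  fix c a assume "a \<in> carrier A"
  then have "as @ a # bs \<in> tuples A n"
    using assms by (simp add: tuples_append)
  then show "Poly_Mapping.single (\<xi>, as @ (c \<odot>\<^bsub>A\<^esub> a) # bs) 1
      - pscale c (Poly_Mapping.single (\<xi>, as @ a # bs) 1) \<in> tensor_rels A M n"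
    unfolding tensor_rels_def pscale_single mult_1_right
    using assms(1) by (intro pm.span_base) blast
qed

text \<open>The universal property of the tensor product: it suffices to check the four kinds of
  spanning relations, as the preimage of \<open>T\<close> is a subspace. With \<open>T\<close> the
  relations one degree lower it makes the boundary well defined; with \<open>T = {0}\<close> it
  yields functionals on chains.\<close>

lemma lin_ext_tensor_rels:
  assumes T: "pm.subspace T"
    and coeff: "\<And>as. as \<in> tuples A n \<Longrightarrow> linear_mod M T (\<lambda>\<xi>. g (\<xi>, as))"
    and slot: "\<And>\<xi> as bs. \<lbrakk>\<xi> \<in> carrier M; set as \<subseteq> carrier A; set bs \<subseteq> carrier A;
        length as + Suc (length bs) = n\<rbrakk> \<Longrightarrow> linear_mod A T (\<lambda>a. g (\<xi>, as @ a # bs))"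
    and f: "f \<in> tensor_rels A M n"
  shows "lin_ext g f \<in> T"
proof -
  have "pm.subspace {f. lin_ext g f \<in> T}"
    by (rule pm.subspaceI)
       (simp_all add: lin_ext_add lin_ext_pscale pm.subspace_0[OF T] pm.subspace_add[OF T]
          pm.subspace_scale[OF T])
  moreover have "lin_ext g (Poly_Mapping.single (\<xi> \<oplus>\<^bsub>M\<^esub> \<eta>, as) 1 - Poly_Mapping.single (\<xi>, as) 1
      - Poly_Mapping.single (\<eta>, as) 1) \<in> T"
    if "\<xi> \<in> carrier M" "\<eta> \<in> carrier M" "as \<in> tuples A n" for \<xi> \<eta> as
    using coeff[OF that(3)] that by (simp add: lin_ext_diff linear_mod_def)
  moreover have "lin_ext g (Poly_Mapping.single (c \<odot>\<^bsub>M\<^esub> \<xi>, as) 1 - Poly_Mapping.single (\<xi>, as) c) \<in> T"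
    if "\<xi> \<in> carrier M" "as \<in> tuples A n" for c \<xi> as
    using coeff[OF that(2)] that by (simp add: lin_ext_diff linear_mod_def)
  moreover have "lin_ext g (Poly_Mapping.single (\<xi>, as @ (a \<oplus>\<^bsub>A\<^esub> a') # bs) 1
      - Poly_Mapping.single (\<xi>, as @ a # bs) 1 - Poly_Mapping.single (\<xi>, as @ a' # bs) 1) \<in> T"
    if "\<xi> \<in> carrier M" "as @ a # bs \<in> tuples A n" "a' \<in> carrier A" for \<xi> as a a' bs
    using slot[of \<xi> as bs] that by (simp add: lin_ext_diff linear_mod_def tuples_append)
  moreover have "lin_ext g (Poly_Mapping.single (\<xi>, as @ (c \<odot>\<^bsub>A\<^esub> a) # bs) 1
      - Poly_Mapping.single (\<xi>, as @ a # bs) c) \<in> T"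
    if "\<xi> \<in> carrier M" "as @ a # bs \<in> tuples A n" for c \<xi> as a bs
    using slot[of \<xi> as bs] that by (simp add: lin_ext_diff linear_mod_def tuples_append)
  ultimately have "tensor_rels A M n \<subseteq> {f. lin_ext g f \<in> T}"
    unfolding tensor_rels_def by (intro pm.span_minimal) blast
  then show ?thesis using f by blast
qed

section \<open>Well-definedness of the Hochschild boundary\<close>

lemma mem_chain_class: "g \<in> chain_class A M n f \<longleftrightarrow> g - f \<in> tensor_rels A M n"
proof -
  have "g = f + (g - f)" by simp
  then show ?thesis unfolding chain_class_def by (auto simp del: add_diff_cancel_left' intro!: image_eqI)
qed

lemma chain_class_eq_iff: "chain_class A M n f = chain_class A M n g \<longleftrightarrow> f - g \<in> tensor_rels A M n"
proof
  have "f \<in> chain_class A M n f"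
    by (simp add: mem_chain_class pm.subspace_0[OF subspace_tensor_rels])
  moreover assume "chain_class A M n f = chain_class A M n g"
  ultimately show "f - g \<in> tensor_rels A M n" by (simp add: mem_chain_class)
next
  assume fg: "f - g \<in> tensor_rels A M n"
  have "h - f \<in> tensor_rels A M n \<longleftrightarrow> h - g \<in> tensor_rels A M n" for h
    using pm.subspace_add[OF subspace_tensor_rels _ fg, of "h - f"]
      pm.subspace_diff[OF subspace_tensor_rels _ fg, of "h - g"]
    by auto
  then show "chain_class A M n f = chain_class A M n g"
    by (auto simp: mem_chain_class)
qed

text \<open>The inner face of the Hochschild complex, indexed from 0: \<open>merge A j\<close>
  belongs to the summand \<open>k = Suc j\<close> of \<open>boundary_gen\<close>.\<close>

definition merge :: "('a, 'z) monoid_scheme \<Rightarrow> nat \<Rightarrow> 'a list \<Rightarrow> 'a list" where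
  "merge A j as = take j as @ (as ! j \<otimes>\<^bsub>A\<^esub> as ! Suc j) # drop (j + 2) as"

lemma boundary_gen_Suc:
  fixes A :: "('k::field, 'a) module" and M :: "('k, 'a, 'b) bimod"
  assumes "length as = Suc n"
  shows "boundary_gen A M (\<xi>, as) =
    Poly_Mapping.single (ract M \<xi> (hd as), tl as) 1
    + (\<Sum>j<n. pscale ((-1) ^ Suc j) (Poly_Mapping.single (\<xi>, merge A j as) 1))
    + pscale ((-1) ^ Suc n) (Poly_Mapping.single (lact M (last as) \<xi>, butlast as) 1)"
proof -
  have shift: "sum g {1..<length as} = (\<Sum>j<n. g (Suc j))" for g :: "nat \<Rightarrow> 'b \<times> 'a list \<Rightarrow>\<^sub>0 'k"
    unfolding assms One_nat_def sum.shift_bounds_Suc_ivl lessThan_atLeast0 ..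
  show ?thesis
    unfolding boundary_gen_def merge_def prod.case shift by (simp add: assms del: power_Suc)
qed

text \<open>Bilinearity of the product and of both actions, which is what makes each face of a
  tensor multilinear in its entries.\<close>

locale hochschild_data =
  fixes A :: "('k::field, 'a) module" and M :: "('k, 'a, 'b) bimod"
  assumes mult_left: "a \<in> carrier A \<Longrightarrow> linear_between A A (\<lambda>b. a \<otimes>\<^bsub>A\<^esub> b)"
    and mult_right: "a \<in> carrier A \<Longrightarrow> linear_between A A (\<lambda>b. b \<otimes>\<^bsub>A\<^esub> a)"
    and ract_left: "\<xi> \<in> carrier M \<Longrightarrow> linear_between A M (\<lambda>a. ract M \<xi> a)"
    and ract_right: "a \<in> carrier A \<Longrightarrow> linear_between M M (\<lambda>\<xi>. ract M \<xi> a)"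
    and lact_left: "a \<in> carrier A \<Longrightarrow> linear_between M M (\<lambda>\<xi>. lact M a \<xi>)"
    and lact_right: "\<xi> \<in> carrier M \<Longrightarrow> linear_between A M (\<lambda>a. lact M a \<xi>)"
begin

lemma mult_closed: "a \<in> carrier A \<Longrightarrow> b \<in> carrier A \<Longrightarrow> a \<otimes>\<^bsub>A\<^esub> b \<in> carrier A"
  using mult_left by (simp add: linear_between_def)

lemma ract_closed: "\<xi> \<in> carrier M \<Longrightarrow> a \<in> carrier A \<Longrightarrow> ract M \<xi> a \<in> carrier M"
  using ract_left by (simp add: linear_between_def)

lemma lact_closed: "\<xi> \<in> carrier M \<Longrightarrow> a \<in> carrier A \<Longrightarrow> lact M a \<xi> \<in> carrier M"
  using lact_left by (simp add: linear_between_def)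

lemma merge_tuples:
  assumes "as \<in> tuples A (Suc n)" "j < n"
  shows "merge A j as \<in> tuples A n"
proof -
  have "as ! i \<in> carrier A" if "i \<le> n" for i
    using assms that by (auto simp: tuples_def subset_iff)
  moreover have "set (take j as) \<subseteq> carrier A" "set (drop (j + 2) as) \<subseteq> carrier A"
    using assms set_take_subset[of j as] set_drop_subset[of "j + 2" as] by (auto simp: tuples_def)
  ultimately show ?thesis
    using assms by (auto simp: merge_def tuples_append mult_closed) (auto simp: tuples_def)
qed

lemma linear_mod_boundary_coeff:
  assumes "as \<in> tuples A (Suc n)"
  shows "linear_mod M (tensor_rels A M n) (\<lambda>\<xi>. boundary_gen A M (\<xi>, as))"
proof -
  have len: "length as = Suc n" and ne: "as \<noteq> []" and sub: "set as \<subseteq> carrier A"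
    using assms by (auto simp: tuples_def)
  have hdl: "hd as \<in> carrier A" "last as \<in> carrier A"
    using sub ne by (auto simp: subset_iff)
  have "tl as \<in> tuples A n" "butlast as \<in> tuples A n"
    using len sub ne by (auto simp: tuples_def dest: in_set_butlastD list.set_sel(2))
  then show ?thesis
    unfolding boundary_gen_Suc[OF len]
    using linear_mod_coeff[of "tl as" A n M] linear_mod_coeff[of "butlast as" A n M]
    by (intro linear_mod_add subspace_tensor_rels linear_mod_sum linear_mod_pscale
        linear_mod_compose[OF _ ract_right] linear_mod_compose[OF _ lact_left] hdl
        linear_mod_coeff merge_tuples assms) auto
qed

lemma linear_mod_merge:
  assumes \<xi>: "\<xi> \<in> carrier M" and as: "set as \<subseteq> carrier A" and bs: "set bs \<subseteq> carrier A"
    and len: "length as + length bs = n" and "j < n"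
  shows "linear_mod A (tensor_rels A M n)
    (\<lambda>a. Poly_Mapping.single (\<xi>, merge A j (as @ a # bs)) 1)"
proof -
  \<comment> \<open>The varying entry has position \<open>length as\<close>. In the outer cases both
    multiplied entries lie on one side of it, and it remains a slot of the merged tensor; in the
    middle cases it is the right or the left factor of the product.\<close>
  consider (before) "Suc j < length as" | (left) "Suc j = length as" | (right) "j = length as"
    | (after) "j > length as" by linarith
  then show ?thesis
  proof cases
    case before
    have "merge A j (as @ a # bs) = merge A j as @ a # bs" for a
      using before by (simp add: merge_def nth_append)
    moreover have "merge A j as \<in> tuples A (length as - 1)"
      using as before by (intro merge_tuples) (auto simp: tuples_def)
    ultimately show ?thesis
      using \<xi> bs len before by (simp add: tuples_def) (rule linear_mod_slot, auto)
  next
    case left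
    have "merge A j (as @ a # bs) = take j as @ (as ! j \<otimes>\<^bsub>A\<^esub> a) # bs" for a
      using left by (simp add: merge_def nth_append)
    moreover have "as ! j \<in> carrier A"
      using as left by (simp add: subset_iff)
    moreover have "set (take j as) \<subseteq> carrier A"
      using as set_take_subset[of j as] by blast
    ultimately show ?thesis
      using \<xi> bs len left
      by (simp, intro linear_mod_compose[OF linear_mod_slot mult_left]) auto
  next
    case right
    then obtain b bs' where b: "bs = b # bs'"
      using len \<open>j < n\<close> by (cases bs) auto
    have "merge A j (as @ a # bs) = as @ (a \<otimes>\<^bsub>A\<^esub> b) # bs'" for a
      using right b by (simp add: merge_def nth_append)
    then show ?thesis
      using \<xi> as bs len b
      by (simp, intro linear_mod_compose[OF linear_mod_slot mult_right]) auto
  next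
    case after
    define i where "i = j - Suc (length as)"
    have j: "j = Suc (length as + i)" using after by (simp add: i_def)
    have "merge A j (as @ a # bs) = as @ a # merge A i bs" for a
      by (simp add: merge_def j nth_append numeral_3_eq_3)
    moreover have "merge A i bs \<in> tuples A (length bs - 1)"
      using bs j len \<open>j < n\<close> by (intro merge_tuples) (auto simp: tuples_def)
    ultimately show ?thesis
      using \<xi> as j len \<open>j < n\<close> by (simp add: tuples_def) (rule linear_mod_slot, auto)
  qed
qed

text \<open>An end slot is absorbed by an action on the coefficient, and linearity there is that of
  the action followed by that of the coefficient. Any other slot survives in the outer faces with a
  fixed coefficient.\<close>

lemma linear_mod_boundary_slot:
  assumes \<xi>: "\<xi> \<in> carrier M" and as: "set as \<subseteq> carrier A" and bs: "set bs \<subseteq> carrier A"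
    and len: "length as + Suc (length bs) = Suc n"
  shows "linear_mod A (tensor_rels A M n) (\<lambda>a. boundary_gen A M (\<xi>, as @ a # bs))"
proof -
  have first: "linear_mod A (tensor_rels A M n)
      (\<lambda>a. Poly_Mapping.single (ract M \<xi> (hd (as @ a # bs)), tl (as @ a # bs)) 1)"
  proof (cases as)
    case Nil
    then have "bs \<in> tuples A n" using bs len by (simp add: tuples_def)
    then show ?thesis
      using linear_mod_compose[OF linear_mod_coeff ract_left[OF \<xi>]] Nil by simp
  next
    case (Cons c as')
    then show ?thesis
      using \<xi> as bs len by (simp, intro linear_mod_slot ract_closed) auto
  qed
  have last: "linear_mod A (tensor_rels A M n)
      (\<lambda>a. Poly_Mapping.single (lact M (last (as @ a # bs)) \<xi>, butlast (as @ a # bs)) 1)"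
  proof (cases bs rule: rev_cases)
    case Nil
    then have "as \<in> tuples A n" using as len by (simp add: tuples_def)
    then show ?thesis
      using linear_mod_compose[OF linear_mod_coeff lact_right[OF \<xi>]] Nil by simp
  next
    case (snoc bs' c)
    then show ?thesis
      using \<xi> as bs len by (simp add: butlast_append, intro linear_mod_slot lact_closed) auto
  qed
  have "length (as @ a # bs) = Suc n" for a using len by simp
  note boundary = boundary_gen_Suc[OF this]
  show ?thesis
    unfolding boundary using len
    by (intro linear_mod_add subspace_tensor_rels linear_mod_sum linear_mod_pscale
        first last linear_mod_merge \<xi> as bs) auto
qed

text \<open>Tensor relations are sent to tensor relations, so every representative contributes the
  same coset to the union in \<open>boundary\<close>.\<close>

lemma boundary_chain_class:
  "boundary A M n (chain_class A M (Suc n) f) = chain_class A M n (lin_ext (boundary_gen A M) f)"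
proof -
  have "chain_class A M n (lin_ext (boundary_gen A M) g) = chain_class A M n (lin_ext (boundary_gen A M) f)"
    if "g \<in> chain_class A M (Suc n) f" for g
    unfolding chain_class_eq_iff lin_ext_diff[symmetric]
    using subspace_tensor_rels linear_mod_boundary_coeff linear_mod_boundary_slot
      that[unfolded mem_chain_class]
    by (rule lin_ext_tensor_rels)
  moreover have "f \<in> chain_class A M (Suc n) f"
    by (simp add: mem_chain_class pm.subspace_0[OF subspace_tensor_rels])
  ultimately show ?thesis unfolding boundary_def by blast
qed

end

context preregular_form
begin

text \<open>On representatives the left action is multiplication by the image under a linear
  endomorphism of the free algebra, so its bilinearity reduces to that of the product.\<close>

sublocale hochschild_data "quad_alg m w" "twisted_bimod m w"
  by unfold_locales
     (auto simp: linear_between_def carrier_quad_alg twisted_bimod_sel(1-4) lact_quad_class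
        free_subst_add free_subst_pscale sign_subst_add sign_subst_pscale
        pscale_times_left pscale_times_right algebra_simps)

end

section \<open>The cycle\<close>

lemma sum_lists_append:
  "(\<Sum>ls | length ls = a + b. F ls) = (\<Sum>p | length p = a. \<Sum>q | length q = b. F (p @ q))"
  for F :: "'a list \<Rightarrow> 'b::comm_monoid_add"
  unfolding sum.cartesian_product
  by (rule sum.reindex_bij_witness[of _ "\<lambda>(p, q). p @ q" "\<lambda>ls. (take a ls, drop a ls)"]) auto

lemma sum_lists_Cons:
  "(\<Sum>ls | length ls = Suc n. F ls) = (\<Sum>l\<in>UNIV. \<Sum>q | length q = n. F (l # q))"
  for F :: "'a list \<Rightarrow> 'b::comm_monoid_add"
  unfolding sum.cartesian_product
  by (rule sum.reindex_bij_witness[of _ "\<lambda>(l, q). l # q" "\<lambda>ls. (hd ls, tl ls)"])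
     (auto simp: length_Suc_conv)

lemma sum_lists_snoc:
  "(\<Sum>ls | length ls = Suc n. F ls) = (\<Sum>l\<in>UNIV. \<Sum>q | length q = n. F (q @ [l]))"
  for F :: "'a list \<Rightarrow> 'b::comm_monoid_add"
  unfolding sum.cartesian_product
  by (rule sum.reindex_bij_witness[of _ "\<lambda>(l, q). q @ [l]" "\<lambda>ls. (last ls, butlast ls)"])
     (auto simp: length_Suc_conv_rev)

section \<open>Transporting relations of the algebra into tensors\<close>

lemma linear_mod_quad_class:
  assumes "linear_mod (quad_alg m w) T G"
  shows "G (quad_class m w (f + g)) - G (quad_class m w f) - G (quad_class m w g) \<in> T"
    and "G (quad_class m w (pscale c f)) - pscale c (G (quad_class m w f)) \<in> T"
  using assms by (simp_all add: linear_mod_def flip: quad_alg_add quad_alg_smult)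

lemma linear_mod_quad_class_ideal:
  assumes T: "pm.subspace T" and G: "linear_mod (quad_alg m w) T G" and "f \<in> quad_ideal m w"
  shows "G (quad_class m w f) \<in> T"
proof -
  \<comment> \<open>Additivity modulo \<open>T\<close> at \<open>0 + 0\<close> leaves exactly
    \<open>- G\<close> of the zero class, so \<open>G\<close> sends zero into
    \<open>T\<close>.\<close>
  have "- G (quad_class m w 0) \<in> T"
    using linear_mod_quad_class(1)[OF G, of 0 0] by simp
  then have "- (- G (quad_class m w 0)) \<in> T" by (rule pm.subspace_neg[OF T])
  moreover have "quad_class m w f = quad_class m w 0"
    using assms by (simp add: quad_class_eq_iff)
  ultimately show ?thesis by simp
qed

lemma linear_mod_quad_class_sum:
  assumes T: "pm.subspace T" and G: "linear_mod (quad_alg m w) T G"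
  shows "(\<Sum>i\<in>S. pscale (c i) (G (quad_class m w (f i))))
    - G (quad_class m w (\<Sum>i\<in>S. pscale (c i) (f i))) \<in> T"
proof (induction S rule: infinite_finite_induct)
  case (insert i S)
  let ?s = "\<Sum>i\<in>S. pscale (c i) (f i)" and ?C = "quad_class m w"
  have "G (?C (pscale (c i) (f i) + ?s)) - G (?C (pscale (c i) (f i))) - G (?C ?s) \<in> T"
    by (rule linear_mod_quad_class[OF G])
  moreover have "G (?C (pscale (c i) (f i))) - pscale (c i) (G (?C (f i))) \<in> T"
    by (rule linear_mod_quad_class[OF G])
  \<comment> \<open>The induction hypothesis corrected by the additivity and homogeneity defects;
    after cancellation this is the claim for \<open>insert i S\<close>.\<close>
  ultimately have "((\<Sum>i\<in>S. pscale (c i) (G (?C (f i)))) - G (?C ?s))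
      - (G (?C (pscale (c i) (f i) + ?s)) - G (?C (pscale (c i) (f i))) - G (?C ?s))
      - (G (?C (pscale (c i) (f i))) - pscale (c i) (G (?C (f i)))) \<in> T"
    by (rule pm.subspace_diff[OF T pm.subspace_diff[OF T insert.IH]])
  then show ?case using insert.hyps by (simp add: algebra_simps)
qed (simp_all add: pm.subspace_neg[OF T] linear_mod_quad_class_ideal[OF T G])

lemma linear_mod_quad_class_sum_ideal:
  assumes "pm.subspace T" "linear_mod (quad_alg m w) T G"
    and "(\<Sum>i\<in>S. pscale (c i) (f i)) \<in> quad_ideal m w"
  shows "(\<Sum>i\<in>S. pscale (c i) (G (quad_class m w (f i)))) \<in> T"
  using pm.subspace_add[OF assms(1) linear_mod_quad_class_sum[OF assms(1,2), of c f S]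
      linear_mod_quad_class_ideal[OF assms]] by simp

section \<open>Cancellation of the faces of the cycle\<close>

context preregular_form
begin

abbreviation gen :: "'n \<Rightarrow> ('n list \<Rightarrow>\<^sub>0 'k) set" where
  "gen l \<equiv> quad_class m w (Poly_Mapping.single [l] 1)"

abbreviation T :: "nat \<Rightarrow> (('n list \<Rightarrow>\<^sub>0 'k) set \<times> ('n list \<Rightarrow>\<^sub>0 'k) set list \<Rightarrow>\<^sub>0 'k) set" where
  "T \<equiv> tensor_rels (quad_alg m w) (twisted_bimod m w)"

abbreviation pure :: "('n list \<Rightarrow>\<^sub>0 'k) set list \<Rightarrow>
    (('n list \<Rightarrow>\<^sub>0 'k) set \<times> ('n list \<Rightarrow>\<^sub>0 'k) set list \<Rightarrow>\<^sub>0 'k)" where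
  "pure as \<equiv> Poly_Mapping.single (quad_class m w 1, as) 1"

lemma set_map_gen: "set (map gen q) \<subseteq> carrier (quad_alg m w)"
  by auto

lemma one_in_carrier: "quad_class m w 1 \<in> carrier (twisted_bimod m w)"
  by (simp add: twisted_bimod_sel)

text \<open>With all letters outside the merged pair fixed, the sum over the pair places a
  contraction of \<open>w\<close> at two adjacent indices into one tensor slot, and that contraction
  is zero in the algebra.\<close>

lemma inner_terms:
  assumes "Suc n = m" "j < n"
  shows "(\<Sum>ls | length ls = m. pscale (form_coeff w ls) (pure (merge (quad_alg m w) j (map gen ls)))) \<in> T n"
proof -
  \<comment> \<open>The number of letters to the right of the merged pair.\<close>
  define b where "b = n - Suc j"
  have m: "m = j + Suc (Suc b)" using assms by (simp add: b_def)
  let ?G = "\<lambda>p q a. pure (map gen p @ a # map gen q)"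
  let ?F = "\<lambda>p q \<mu> \<nu>. pscale (form_coeff w (p @ \<mu> # \<nu> # q))
      (?G p q (quad_class m w (Poly_Mapping.single [\<mu>, \<nu>] 1)))"
  have "(\<Sum>ls | length ls = m. pscale (form_coeff w ls) (pure (merge (quad_alg m w) j (map gen ls))))
      = (\<Sum>p | length p = j. \<Sum>\<mu>\<in>UNIV. \<Sum>\<nu>\<in>UNIV. \<Sum>q | length q = b. ?F p q \<mu> \<nu>)"
    unfolding m sum_lists_append sum_lists_Cons
    by (intro sum.cong refl) (simp add: merge_def nth_append single_word_mult)
  also have "\<dots> = (\<Sum>p | length p = j. \<Sum>q | length q = b. \<Sum>\<mu>\<in>UNIV. \<Sum>\<nu>\<in>UNIV. ?F p q \<mu> \<nu>)"
    by (rule sum.cong[OF refl], rule trans[OF sum.cong[OF refl sum.swap] sum.swap])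
  also have "\<dots> \<in> T n"
  proof (rule pm.subspace_sum[OF subspace_tensor_rels], rule pm.subspace_sum[OF subspace_tensor_rels])
    fix p q :: "'n list" assume "p \<in> {p. length p = j}" "q \<in> {q. length q = b}"
    then have pq: "length p + length q = m - 2" "length p + Suc (length q) = n"
      using m assms by auto
    have "(\<Sum>(\<mu>,\<nu>)\<in>UNIV \<times> UNIV. ?F p q \<mu> \<nu>) \<in> T n"
      unfolding split_def
    proof (rule linear_mod_quad_class_sum_ideal[OF subspace_tensor_rels])
      show "linear_mod (quad_alg m w) (T n) (?G p q)"
        using pq by (intro linear_mod_slot one_in_carrier set_map_gen) simp
      show "(\<Sum>i\<in>UNIV \<times> UNIV. pscale (form_coeff w (p @ fst i # snd i # q))
          (Poly_Mapping.single [fst i, snd i] 1)) \<in> quad_ideal m w"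
        using quad_ideal_adjacent[OF pq(1)] unfolding sum.cartesian_product split_def by simp
    qed
    then show "(\<Sum>\<mu>\<in>UNIV. \<Sum>\<nu>\<in>UNIV. ?F p q \<mu> \<nu>) \<in> T n"
      by (simp add: sum.cartesian_product)
  qed
  finally show ?thesis .
qed

text \<open>The inverse twist in the left action contracts the last index of \<open>w\<close> with
  \<open>Q'\<close>, and the twist condition read backwards turns this into \<open>w\<close> with
  the index in front. The two sums then differ only by sign.\<close>

lemma outer_sum_eq_0:
  assumes "Suc (length q) = m"
  shows "(\<Sum>l\<in>UNIV. pscale (form_coeff w (l # q)) (Poly_Mapping.single [l] 1))
    + (\<Sum>l\<in>UNIV. pscale ((-1) ^ m * form_coeff w (q @ [l]))
        (sign_subst m (free_subst Q' (Poly_Mapping.single [l] 1)))) = 0"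
proof -
  have coeff: "(\<Sum>l\<in>UNIV. form_coeff w (q @ [l]) * Q' $ l $ \<mu>) = form_coeff w (\<mu> # q)" for \<mu>
  proof -
    \<comment> \<open>Inserting \<open>Q\<close> after \<open>Q'\<close> prepares the first argument
      for the twist condition.\<close>
    have "form_coeff w (\<mu> # q) = w ((Q *v (Q' *v basis_vec \<mu>)) # map basis_vec q)"
      by (simp add: form_coeff_def)
    also have "\<dots> = w (map basis_vec q @ [Q' *v basis_vec \<mu>])"
      using Q_twists assms by (auto simp: twists_form_def)
    also have "\<dots> = (\<Sum>l\<in>UNIV. Q' $ l $ \<mu> * w (map basis_vec q @ [basis_vec l]))"
      using assms by (subst matrix_vector_mult_basis_vec, subst form_sum) auto
    finally show ?thesis by (simp add: form_coeff_def mult.commute)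
  qed
  \<comment> \<open>The factor \<open>(-1) ^ m\<close> comes from the last face of the boundary and
    \<open>(-1) ^ (m - 1)\<close> from the left action of a degree 1 element.\<close>
  have sign: "(-1) ^ m * (c * (-1) ^ (m - 1)) = - c" for c :: 'k
    using assms by (cases m) (simp_all flip: power_add)
  have "(\<Sum>l\<in>UNIV. pscale ((-1) ^ m * form_coeff w (q @ [l]))
        (sign_subst m (free_subst Q' (Poly_Mapping.single [l] 1))))
      = (\<Sum>l\<in>UNIV. \<Sum>\<mu>\<in>UNIV. Poly_Mapping.single [\<mu>]
          ((-1) ^ m * ((form_coeff w (q @ [l]) * Q' $ l $ \<mu>) * (-1) ^ (m - 1))))"
    by (simp add: free_subst_generator sign_subst_sum sign_subst_single pm.scale_sum_right mult_ac)
  also have "\<dots> = - (\<Sum>\<mu>\<in>UNIV. Poly_Mapping.single [\<mu>] (form_coeff w (\<mu> # q)))"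
    unfolding sign by (subst sum.swap) (simp add: single_uminus sum_negf single_sum flip: coeff)
  finally show ?thesis by simp
qed

text \<open>After reindexing, both outer faces leave the same word \<open>q\<close> in the tensor
  slots, so for each \<open>q\<close> they combine in the coefficient slot, where
  \<open>outer_sum_eq_0\<close> applies.\<close>

lemma outer_terms:
  assumes "Suc n = m"
  shows "(\<Sum>ls | length ls = m. pscale (form_coeff w ls)
            (Poly_Mapping.single (ract (twisted_bimod m w) (quad_class m w 1) (hd (map gen ls)), tl (map gen ls)) 1))
    + (\<Sum>ls | length ls = m. pscale ((-1) ^ m * form_coeff w ls)
            (Poly_Mapping.single (lact (twisted_bimod m w) (last (map gen ls)) (quad_class m w 1), butlast (map gen ls)) 1))
    \<in> T n"
proof -
  let ?G = "\<lambda>q \<xi>. Poly_Mapping.single (\<xi>, map gen q) (1 :: 'k)"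
  let ?y = "\<lambda>l. sign_subst m (free_subst Q' (Poly_Mapping.single [l] 1))"
  let ?A = "\<lambda>q. \<Sum>l\<in>UNIV. pscale (form_coeff w (l # q)) (?G q (gen l))"
  let ?B = "\<lambda>q. \<Sum>l\<in>UNIV. pscale ((-1) ^ m * form_coeff w (q @ [l])) (?G q (quad_class m w (?y l)))"
  have first: "(\<Sum>ls | length ls = m. pscale (form_coeff w ls)
      (Poly_Mapping.single (ract (twisted_bimod m w) (quad_class m w 1) (hd (map gen ls)), tl (map gen ls)) 1))
      = (\<Sum>q | length q = n. ?A q)"
    unfolding assms[symmetric] sum_lists_Cons
    by (subst sum.swap) (simp add: twisted_bimod_sel)
  have last: "(\<Sum>ls | length ls = m. pscale ((-1) ^ m * form_coeff w ls)
      (Poly_Mapping.single (lact (twisted_bimod m w) (last (map gen ls)) (quad_class m w 1), butlast (map gen ls)) 1))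
      = (\<Sum>q | length q = n. ?B q)"
    unfolding sum_lists_snoc[where n = n, unfolded assms]
    by (subst sum.swap) (simp add: lact_quad_class)
  have "?A q + ?B q \<in> T n" if "length q = n" for q
  proof -
    let ?a = "\<Sum>l\<in>UNIV. pscale (form_coeff w (l # q)) (Poly_Mapping.single [l] 1)"
    let ?b = "\<Sum>l\<in>UNIV. pscale ((-1) ^ m * form_coeff w (q @ [l])) (?y l)"
    let ?H = "\<lambda>f. ?G q (quad_class m w f)"
    have "map gen q \<in> tuples (quad_alg m w) n"
      using that by (auto simp: tuples_def)
    from linear_mod_coeff[OF this, of "twisted_bimod m w"]
    have G: "linear_mod (quad_alg m w) (T n) (?G q)"
      by (simp add: linear_mod_def twisted_bimod_sel)
    note sums = linear_mod_quad_class_sum[OF subspace_tensor_rels G]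
    have ab: "?H (?a + ?b) - ?H ?a - ?H ?b \<in> T n"
      by (rule linear_mod_quad_class[OF G])
    have "?a + ?b = 0"
      using that assms by (intro outer_sum_eq_0) simp
    then have "?H (?a + ?b) \<in> T n"
      by (intro linear_mod_quad_class_ideal[OF subspace_tensor_rels G]) (simp only: quad_ideal_0)
    then have "?H (?a + ?b) - (?H (?a + ?b) - ?H ?a - ?H ?b) \<in> T n"
      using ab by (rule pm.subspace_diff[OF subspace_tensor_rels])
    \<comment> \<open>All auxiliary terms cancel and \<open>?A q + ?B q\<close> remains.\<close>
    then have "((?A q - ?H ?a) + (?B q - ?H ?b)) + (?H (?a + ?b) - (?H (?a + ?b) - ?H ?a - ?H ?b)) \<in> T n"
      by (rule pm.subspace_add[OF subspace_tensor_rels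
            pm.subspace_add[OF subspace_tensor_rels sums sums]])
    then show ?thesis by (simp add: algebra_simps)
  qed
  then have "(\<Sum>q | length q = n. ?A q + ?B q) \<in> T n"
    by (intro pm.subspace_sum subspace_tensor_rels) auto
  then show ?thesis
    unfolding first last sum.distrib .
qed

abbreviation one_tensor_rep where
  "one_tensor_rep \<equiv> \<Sum>ls | length ls = m.
     Poly_Mapping.single (quad_class m w 1, map gen ls) (form_coeff w ls)"

lemma one_tensor_eq:
  "one_tensor m w = chain_class (quad_alg m w) (twisted_bimod m w) m one_tensor_rep"
  by (simp add: one_tensor_def quad_alg_one quad_gen_eq[abs_def])

lemma boundary_one_tensor_rep:
  assumes "Suc n = m"
  shows "lin_ext (boundary_gen (quad_alg m w) (twisted_bimod m w)) one_tensor_rep \<in> T n"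
proof -
  let ?A = "quad_alg m w" and ?M = "twisted_bimod m w"
  let ?first = "\<lambda>ls. Poly_Mapping.single (ract ?M (quad_class m w 1) (hd (map gen ls)), tl (map gen ls)) (1::'k)"
  let ?last = "\<lambda>ls. Poly_Mapping.single (lact ?M (last (map gen ls)) (quad_class m w 1), butlast (map gen ls)) (1::'k)"
  let ?inner = "\<lambda>j ls. pure (merge ?A j (map gen ls))"
  have gen: "boundary_gen ?A ?M (quad_class m w 1, map gen ls)
      = ?first ls + (\<Sum>j<n. pscale ((-1) ^ Suc j) (?inner j ls)) + pscale ((-1) ^ m) (?last ls)"
    if "length ls = m" for ls
    using that assms by (subst boundary_gen_Suc[of _ n]) auto
  have "lin_ext (boundary_gen ?A ?M) one_tensor_rep
      = (\<Sum>ls | length ls = m. pscale (form_coeff w ls) (boundary_gen ?A ?M (quad_class m w 1, map gen ls)))"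
    by (simp add: lin_ext_sum)
  also have "\<dots> = (\<Sum>ls | length ls = m. pscale (form_coeff w ls) (?first ls)
      + (\<Sum>j<n. pscale ((-1) ^ Suc j) (pscale (form_coeff w ls) (?inner j ls)))
      + pscale ((-1) ^ m * form_coeff w ls) (?last ls))"
    by (intro sum.cong refl)
       (simp add: gen pm.scale_right_distrib pm.scale_sum_right mult_ac del: pscale_single)
  also have "\<dots> = (\<Sum>ls | length ls = m. pscale (form_coeff w ls) (?first ls))
      + (\<Sum>j<n. pscale ((-1) ^ Suc j) (\<Sum>ls | length ls = m. pscale (form_coeff w ls) (?inner j ls)))
      + (\<Sum>ls | length ls = m. pscale ((-1) ^ m * form_coeff w ls) (?last ls))"
    unfolding sum.distrib pm.scale_sum_right by (subst sum.swap) (rule refl)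
  also have "\<dots> = ((\<Sum>ls | length ls = m. pscale (form_coeff w ls) (?first ls))
      + (\<Sum>ls | length ls = m. pscale ((-1) ^ m * form_coeff w ls) (?last ls)))
      + (\<Sum>j<n. pscale ((-1) ^ Suc j) (\<Sum>ls | length ls = m. pscale (form_coeff w ls) (?inner j ls)))"
    by (simp only: add_ac)
  also have "\<dots> \<in> T n"
    using assms
    by (intro pm.subspace_add pm.subspace_sum pm.subspace_scale subspace_tensor_rels
        inner_terms outer_terms) auto
  finally show ?thesis .
qed

lemma one_tensor_cycle: "one_tensor m w \<in> hoch_cycles (quad_alg m w) (twisted_bimod m w) m"
proof -
  let ?A = "quad_alg m w" and ?M = "twisted_bimod m w"
  obtain n where n: "Suc n = m" using m_ge_2 by (cases m) auto
  have "Poly_Mapping.keys one_tensor_rep \<subseteq> carrier ?M \<times> tuples ?A m"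
    using one_in_carrier by (intro order.trans[OF keys_sum]) (auto simp: tuples_def split: if_splits)
  then have "one_tensor m w \<in> chains ?A ?M m"
    unfolding one_tensor_eq chains_def free_chains_def by blast
  \<comment> \<open>The class of 0 is the coset \<open>tensor_rels\<close> itself, that is, the zero
    chain.\<close>
  moreover have "boundary ?A ?M n (one_tensor m w) = chain_class ?A ?M n 0"
    using boundary_chain_class[of n one_tensor_rep] boundary_one_tensor_rep[OF n]
    unfolding n one_tensor_eq by (simp add: chain_class_eq_iff)
  moreover have "hoch_cycles ?A ?M (Suc n)
      = {X \<in> chains ?A ?M (Suc n). boundary ?A ?M n X = tensor_rels ?A ?M n}"
    by (simp add: hoch_cycles_def)
  ultimately show ?thesis
    unfolding n by (simp add: chain_class_def)
qed

end

section \<open>Nontriviality\<close>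

lemma lookup_mult_Nil:
  "Poly_Mapping.lookup (f * g) [] = Poly_Mapping.lookup f [] * Poly_Mapping.lookup g []"
  for f g :: "'n list \<Rightarrow>\<^sub>0 'k::field"
proof (rule additive_eqI[where f = f])
  show "Poly_Mapping.lookup (Poly_Mapping.single x a * g) []
      = Poly_Mapping.lookup (Poly_Mapping.single x a) [] * Poly_Mapping.lookup g []" for x a
    by (rule additive_eqI[where f = g])
       (auto simp: single_word_mult algebra_simps lookup_add lookup_single when_def)
qed (auto simp: algebra_simps lookup_add)

text \<open>A one-letter word factors only with an empty factor on one side. This is the Leibniz
  rule for a derivation along the augmentation.\<close>

lemma lookup_mult_generator:
  "Poly_Mapping.lookup (f * g) [l]
     = Poly_Mapping.lookup f [] * Poly_Mapping.lookup g [l]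
       + Poly_Mapping.lookup f [l] * Poly_Mapping.lookup g []"
  for f g :: "'n list \<Rightarrow>\<^sub>0 'k::field"
proof (rule additive_eqI[where f = f])
  show "Poly_Mapping.lookup (Poly_Mapping.single x a * g) [l]
      = Poly_Mapping.lookup (Poly_Mapping.single x a) [] * Poly_Mapping.lookup g [l]
       + Poly_Mapping.lookup (Poly_Mapping.single x a) [l] * Poly_Mapping.lookup g []" for x a
    by (rule additive_eqI[where f = g])
       (auto simp: single_word_mult algebra_simps lookup_add lookup_single when_def
          append_eq_Cons_conv)
qed (auto simp: algebra_simps lookup_add)

lemma lookup_free_subst_Nil:
  "Poly_Mapping.lookup (free_subst P f) [] = Poly_Mapping.lookup f []"
proof (rule additive_eqI[where f = f])
  show "Poly_Mapping.lookup (free_subst P (Poly_Mapping.single xs c)) []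
      = Poly_Mapping.lookup (Poly_Mapping.single xs c) []" for xs c
    by (cases xs) (simp_all add: free_subst_def lookup_mult_Nil lookup_sum lookup_single lookup_one
        zero_list_def)
qed (auto simp: free_subst_add lookup_add)

lemma lookup_sign_subst_Nil:
  "Poly_Mapping.lookup (sign_subst m f) [] = Poly_Mapping.lookup f []"
proof (rule additive_eqI[where f = f])
  show "Poly_Mapping.lookup (sign_subst m (Poly_Mapping.single xs c)) []
      = Poly_Mapping.lookup (Poly_Mapping.single xs c) []" for xs c
    by (cases xs) (simp_all add: sign_subst_single lookup_single)
qed (auto simp: sign_subst_add lookup_add)

text \<open>Elements without terms of degree 0 and 1 form an ideal, and the relations, being
  quadratic, lie in it.\<close>

lemma lookup_quad_ideal:
  assumes "f \<in> quad_ideal m w"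
  shows "Poly_Mapping.lookup f [] = 0" "Poly_Mapping.lookup f [l] = 0"
proof -
  have "f \<in> {f. \<forall>l. Poly_Mapping.lookup f [] = 0 \<and> Poly_Mapping.lookup f [l] = 0}"
    by (rule quad_ideal_minimal[OF assms])
       (auto simp: quad_rels_def lookup_sum lookup_single lookup_add lookup_mult_Nil
          lookup_mult_generator)
  then show "Poly_Mapping.lookup f [] = 0" "Poly_Mapping.lookup f [l] = 0" by auto
qed

text \<open>The coefficients of words of length at most one do not depend on the representative.\<close>

definition class_coeff :: "('n list \<Rightarrow>\<^sub>0 'k::field) set \<Rightarrow> 'n list \<Rightarrow> 'k" where
  "class_coeff X xs = Poly_Mapping.lookup (SOME f. f \<in> X) xs"

lemma class_coeff_quad_class:
  "class_coeff (quad_class m w f) [] = Poly_Mapping.lookup f []"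
  "class_coeff (quad_class m w f) [l] = Poly_Mapping.lookup f [l]"
proof -
  have "f \<in> quad_class m w f" by (simp add: mem_quad_class)
  then have "(SOME g. g \<in> quad_class m w f) \<in> quad_class m w f"
    by (rule someI)
  then have "(SOME g. g \<in> quad_class m w f) - f \<in> quad_ideal m w"
    by (simp add: mem_quad_class)
  from lookup_quad_ideal[OF this]
  show "class_coeff (quad_class m w f) [] = Poly_Mapping.lookup f []"
    "class_coeff (quad_class m w f) [l] = Poly_Mapping.lookup f [l]"
    by (simp_all add: class_coeff_def lookup_minus)
qed

section \<open>The functional on chains that detects the cycle\<close>

definition tensor_coeff :: "'n list \<Rightarrow> ('n list \<Rightarrow>\<^sub>0 'k::field) set list \<Rightarrow> 'k" where
  "tensor_coeff ls as = prod_list (map (\<lambda>(l, a). class_coeff a [l]) (zip ls as))"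

lemma tensor_coeff_append:
  "length ls = length as \<Longrightarrow>
    tensor_coeff (ls @ ls') (as @ as') = tensor_coeff ls as * tensor_coeff ls' as'"
  by (simp add: tensor_coeff_def)

lemma tensor_coeff_Cons:
  "tensor_coeff (l # ls) (a # as) = class_coeff a [l] * tensor_coeff ls as"
  by (simp add: tensor_coeff_def)

lemma tensor_coeff_Nil: "tensor_coeff [] as = 1"
  by (simp add: tensor_coeff_def)

text \<open>Functions on \<open>unit\<close> form a copy of the ground field; taking values there
  lets \<open>lin_ext\<close> and \<open>lin_ext_tensor_rels\<close> apply to a scalar
  functional.\<close>

definition chain_coeff :: "'n list \<Rightarrow>
    ('n list \<Rightarrow>\<^sub>0 'k::field) set \<times> ('n list \<Rightarrow>\<^sub>0 'k) set list \<Rightarrow> (unit \<Rightarrow>\<^sub>0 'k)" where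
  "chain_coeff ls = (\<lambda>(\<xi>, as). Poly_Mapping.single () (class_coeff \<xi> [] * tensor_coeff ls as))"

text \<open>Every \<open>S j\<close> occurs twice with opposite signs, the end values being matched
  by the two outer terms.\<close>

lemma alternating_sum_telescope:
  "S 0 + (\<Sum>j<n. (-1) ^ Suc j * (S j + S (Suc j))) + (-1) ^ Suc n * S n = (0 :: 'k::comm_ring_1)"
  by (induction n) (auto simp: algebra_simps)

context preregular_form
begin

lemma class_coeff_mult:
  assumes "a \<in> carrier (quad_alg m w)" "b \<in> carrier (quad_alg m w)"
  shows "class_coeff (a \<otimes>\<^bsub>quad_alg m w\<^esub> b) [] = class_coeff a [] * class_coeff b []"
    and "class_coeff (a \<otimes>\<^bsub>quad_alg m w\<^esub> b) [l]
      = class_coeff a [] * class_coeff b [l] + class_coeff a [l] * class_coeff b []"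
  using assms
  by (auto simp: carrier_quad_alg class_coeff_quad_class lookup_mult_Nil lookup_mult_generator)

lemma class_coeff_linear:
  assumes "a \<in> carrier (quad_alg m w)" "b \<in> carrier (quad_alg m w)" "length xs < 2"
  shows "class_coeff (a \<oplus>\<^bsub>quad_alg m w\<^esub> b) xs = class_coeff a xs + class_coeff b xs"
    and "class_coeff (c \<odot>\<^bsub>quad_alg m w\<^esub> a) xs = c * class_coeff a xs"
proof -
  have "xs = [] \<or> (\<exists>l. xs = [l])"
    using assms(3) by (cases xs) auto
  then show "class_coeff (a \<oplus>\<^bsub>quad_alg m w\<^esub> b) xs = class_coeff a xs + class_coeff b xs"
    "class_coeff (c \<odot>\<^bsub>quad_alg m w\<^esub> a) xs = c * class_coeff a xs"
    using assms(1,2) by (auto simp: carrier_quad_alg class_coeff_quad_class lookup_add)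
qed

text \<open>The twist is invisible to the augmentation: linear substitutions and the degree sign
  both fix constant terms.\<close>

lemma class_coeff_lact:
  assumes "a \<in> carrier (quad_alg m w)" "\<xi> \<in> carrier (quad_alg m w)"
  shows "class_coeff (lact (twisted_bimod m w) a \<xi>) [] = class_coeff a [] * class_coeff \<xi> []"
  using assms
  by (auto simp: carrier_quad_alg lact_quad_class class_coeff_quad_class lookup_mult_Nil
      lookup_sign_subst_Nil lookup_free_subst_Nil)

lemma chain_coeff_tensor_rels:
  assumes "f \<in> T m" "length ls = m"
  shows "lin_ext (chain_coeff ls) f = 0"
proof -
  have "lin_ext (chain_coeff ls) f \<in> {0}"
  proof (rule lin_ext_tensor_rels[OF pm.subspace_single_0 _ _ assms(1)])
    show "linear_mod (twisted_bimod m w) {0} (\<lambda>\<xi>. chain_coeff ls (\<xi>, as))" for as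
      by (simp add: linear_mod_def twisted_bimod_sel chain_coeff_def class_coeff_linear
          algebra_simps single_add)
  next
    fix \<xi> :: "('n list \<Rightarrow>\<^sub>0 'k) set" and as bs :: "('n list \<Rightarrow>\<^sub>0 'k) set list"
    assume "length as + Suc (length bs) = m"
    \<comment> \<open>The letter \<open>l\<close> reads the varying slot, so the functional is the
      linear coefficient at \<open>l\<close> times factors independent of \<open>a\<close>.\<close>
    then obtain l where ls: "ls = take (length as) ls @ l # drop (Suc (length as)) ls"
      using assms(2) id_take_nth_drop[of "length as" ls] by auto
    have "tensor_coeff ls (as @ a # bs) = tensor_coeff (take (length as) ls) as
        * class_coeff a [l] * tensor_coeff (drop (Suc (length as)) ls) bs" for a
      using \<open>length as + Suc (length bs) = m\<close> assms(2)
      by (subst ls) (simp add: tensor_coeff_append tensor_coeff_Cons)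
    then show "linear_mod (quad_alg m w) {0} (\<lambda>a. chain_coeff ls (\<xi>, as @ a # bs))"
      by (simp add: linear_mod_def chain_coeff_def class_coeff_linear algebra_simps single_add)
  qed
  then show ?thesis by simp
qed

lemma chain_coeff_boundary_gen:
  assumes ls: "length ls = m" and \<xi>: "\<xi> \<in> carrier (quad_alg m w)"
    and as: "as \<in> tuples (quad_alg m w) (Suc m)"
  shows "lin_ext (chain_coeff ls) (boundary_gen (quad_alg m w) (twisted_bimod m w) (\<xi>, as)) = 0"
proof -
  have len: "length as = Suc m" and sub: "set as \<subseteq> carrier (quad_alg m w)"
    using as by (auto simp: tuples_def)
  have nth: "as ! i \<in> carrier (quad_alg m w)" if "i \<le> m" for i
    using sub len that by (simp add: subset_iff)
  define e where "e = class_coeff \<xi> []"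
  \<comment> \<open>\<open>S j\<close> applies the augmentation to the entry at position
    \<open>j\<close> and lets the letters of \<open>ls\<close> read the other \<open>m\<close>
    entries in order. The outer faces give \<open>S 0\<close> and \<open>S m\<close>, and by the
    Leibniz rule the inner face \<open>j\<close> gives \<open>S j + S (Suc j)\<close>.\<close>
  define S where "S j = e * (tensor_coeff (take j ls) (take j as) * class_coeff (as ! j) []
      * tensor_coeff (drop j ls) (drop (Suc j) as))" for j
  have "hd as = as ! 0" "tl as = drop (Suc 0) as"
    using len by (cases as; simp)+
  then have first: "chain_coeff ls (ract (twisted_bimod m w) \<xi> (hd as), tl as) = Poly_Mapping.single () (S 0)"
    using \<xi> nth[of 0]
    by (simp add: chain_coeff_def S_def e_def twisted_bimod_sel class_coeff_mult tensor_coeff_Nil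
        mult.assoc)
  have "last as = as ! m"
    using len by (subst last_conv_nth) auto
  moreover have "butlast as = take m as"
    using len by (simp add: butlast_conv_take)
  ultimately have last: "chain_coeff ls (lact (twisted_bimod m w) (last as) \<xi>, butlast as)
      = Poly_Mapping.single () (S m)"
    using \<xi> nth[of m] ls
    by (simp add: chain_coeff_def S_def e_def class_coeff_lact tensor_coeff_Nil mult_ac)
  have inner: "chain_coeff ls (\<xi>, merge (quad_alg m w) j as) = Poly_Mapping.single () (S j + S (Suc j))"
    if "j < m" for j
  proof -
    have split: "ls = take j ls @ ls ! j # drop (Suc j) ls"
      "drop j ls = ls ! j # drop (Suc j) ls" "take (Suc j) ls = take j ls @ [ls ! j]"
      "drop (Suc j) as = as ! Suc j # drop (Suc (Suc j)) as" "take (Suc j) as = take j as @ [as ! j]"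
      using that ls len
      by (simp_all add: id_take_nth_drop[symmetric] Cons_nth_drop_Suc take_Suc_conv_app_nth)
    have "tensor_coeff ls (merge (quad_alg m w) j as)
        = tensor_coeff (take j ls) (take j as) * (class_coeff (as ! j \<otimes>\<^bsub>quad_alg m w\<^esub> as ! Suc j) [ls ! j]
          * tensor_coeff (drop (Suc j) ls) (drop (Suc (Suc j)) as))"
      using that ls len
      by (subst split(1)) (simp add: merge_def tensor_coeff_append tensor_coeff_Cons)
    moreover have "S j = e * (tensor_coeff (take j ls) (take j as) * class_coeff (as ! j) []
        * (class_coeff (as ! Suc j) [ls ! j] * tensor_coeff (drop (Suc j) ls) (drop (Suc (Suc j)) as)))"
      unfolding S_def split(2,4) tensor_coeff_Cons ..
    moreover have "S (Suc j) = e * (tensor_coeff (take j ls) (take j as) * class_coeff (as ! j) [ls ! j]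
        * class_coeff (as ! Suc j) [] * tensor_coeff (drop (Suc j) ls) (drop (Suc (Suc j)) as))"
      using that ls len
      unfolding S_def split(3,5) by (simp add: tensor_coeff_append tensor_coeff_Cons tensor_coeff_Nil)
    ultimately show ?thesis
      using that nth[of j] nth[of "Suc j"]
      by (simp add: chain_coeff_def class_coeff_mult algebra_simps flip: e_def)
  qed
  have "lin_ext (chain_coeff ls) (boundary_gen (quad_alg m w) (twisted_bimod m w) (\<xi>, as))
      = Poly_Mapping.single () (S 0) + (\<Sum>j<m. pscale ((-1) ^ Suc j) (Poly_Mapping.single () (S j + S (Suc j))))
        + pscale ((-1) ^ Suc m) (Poly_Mapping.single () (S m))"
    unfolding boundary_gen_Suc[OF len] lin_ext_add lin_ext_sum lin_ext_pscale lin_ext_single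
    by (simp add: first last inner del: pscale_single power_Suc)
  also have "\<dots> = Poly_Mapping.single () (S 0 + (\<Sum>j<m. (-1) ^ Suc j * (S j + S (Suc j))) + (-1) ^ Suc m * S m)"
    unfolding pscale_single single_sum[symmetric] single_add[symmetric] ..
  finally show ?thesis by (simp only: alternating_sum_telescope single_zero)
qed

lemma tensor_coeff_gen:
  "length ls = length ls' \<Longrightarrow> tensor_coeff ls (map gen ls') = (if ls = ls' then 1 else 0)"
  by (induction ls ls' rule: list_induct2)
     (auto simp: tensor_coeff_Nil tensor_coeff_Cons class_coeff_quad_class lookup_single)

lemma finite_words: "finite {ls :: 'n list. length ls = n}"
  using finite_lists_length_eq[of "UNIV :: 'n set" n] by simp

lemma one_tensor_not_boundary:
  "one_tensor m w \<notin> hoch_boundaries (quad_alg m w) (twisted_bimod m w) m"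
proof
  let ?b = "lin_ext (boundary_gen (quad_alg m w) (twisted_bimod m w))"
  assume "one_tensor m w \<in> hoch_boundaries (quad_alg m w) (twisted_bimod m w) m"
  then obtain f where f: "f \<in> free_chains (quad_alg m w) (twisted_bimod m w) (Suc m)"
    and eq: "one_tensor m w = boundary (quad_alg m w) (twisted_bimod m w) m
      (chain_class (quad_alg m w) (twisted_bimod m w) (Suc m) f)"
    unfolding hoch_boundaries_def chains_def by blast
  obtain ls where ls: "length ls = m" "form_coeff w ls \<noteq> 0"
    by (rule form_coeff_nonzero)
  have "one_tensor_rep - ?b f \<in> T m"
    using eq by (simp add: one_tensor_eq boundary_chain_class chain_class_eq_iff)
  then have "lin_ext (chain_coeff ls) (one_tensor_rep - ?b f) = 0"
    by (rule chain_coeff_tensor_rels[OF _ ls(1)])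
  then have "lin_ext (chain_coeff ls) one_tensor_rep = lin_ext (chain_coeff ls) (?b f)"
    by (simp only: lin_ext_diff right_minus_eq)
  also have "\<dots> = 0"
    \<comment> \<open>The boundary is expanded over the support of \<open>f\<close>, and the
      functional vanishes on the boundary of each elementary tensor.\<close>
    unfolding lin_ext_def[of "boundary_gen _ _"] lin_ext_sum lin_ext_pscale
  proof (rule sum.neutral, rule ballI)
    fix x assume "x \<in> Poly_Mapping.keys f"
    then have "fst x \<in> carrier (quad_alg m w)" "snd x \<in> tuples (quad_alg m w) (Suc m)"
      using f by (auto simp: free_chains_def twisted_bimod_sel)
    then show "pscale (Poly_Mapping.lookup f x)
        (lin_ext (chain_coeff ls) (boundary_gen (quad_alg m w) (twisted_bimod m w) x)) = 0"
      using chain_coeff_boundary_gen[OF ls(1), of "fst x" "snd x"] by simp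
  qed
  \<comment> \<open>On words of generators the functional is dual to the word \<open>ls\<close>, so
    only the coefficient of \<open>w\<close> at \<open>ls\<close> survives.\<close>
  also have "lin_ext (chain_coeff ls) one_tensor_rep
      = (\<Sum>ls' | length ls' = m. if ls' = ls then Poly_Mapping.single () (form_coeff w ls) else 0)"
    unfolding lin_ext_sum
    by (intro sum.cong refl)
       (auto simp: chain_coeff_def tensor_coeff_gen ls class_coeff_quad_class one_free_alg)
  also have "\<dots> = Poly_Mapping.single () (form_coeff w ls)"
    using ls by (simp add: finite_words)
  finally show False
    using ls(2) by (metis lookup_single_eq lookup_zero)
qed

end

theorem proposition10:
  fixes m :: nat
    and w :: "('k::{alg_closed_field, field_char_0} ^ 'n::finite) list \<Rightarrow> 'k"
  assumes "m \<ge> 2" and "CARD('n) \<ge> 2" and "preregular m w"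
  shows "one_tensor m w \<in> hoch_cycles (quad_alg m w) (twisted_bimod m w) m \<and>
         one_tensor m w \<notin> hoch_boundaries (quad_alg m w) (twisted_bimod m w) m"
proof -
  interpret preregular_form m w
    using assms by unfold_locales
  show ?thesis
    using one_tensor_cycle one_tensor_not_boundary by simp
qed

end
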